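(* Let $k$ be a field, $D$ an associative unital $k$-algebra with multiplication $\mu_D$ and unit $1_D$, $W$ a vector space with a distinguished element $1_W\in W$, and $V$ a vector space with a distinguished element $1_V\in V$. Let $W\overline{\otimes}_{P,\nu}D$ be a mirror crossed product and $D\otimes_{R,\sigma}V$ a crossed product (as defined in the context). Suppose that on $W\otimes D\otimes V$ we have an associative unital algebra structure, with multiplication denoted by $\cdot$, such that the maps $$W\overline{\otimes}_{P,\nu}D\to W\otimes D\otimes V,\quad w\otimes d\mapsto w\otimes d\otimes 1_V,$$ $$D\otimes_{R,\sigma}V\to W\otimes D\otimes V,\quad d\otimes v\mapsto 1_W\otimes d\otimes v,$$ are (unital) algebra maps (in particular the unit of $W\otimes D\otimes V$ is $1_W\otimes 1_D\otimes 1_V$) and moreover, for all $w\in W$, $d\in D$, $v\in V$, $$w\otimes d\otimes v=(w\otimes 1_D\otimes 1_V)\cdot(1_W\otimes d\otimes 1_V)\cdot(1_W\otimes 1_D\otimes v).$$ Then there exists a linear map $Q:V\otimes W\to W\otimes D\otimes V$ which is an iteration map for $(P,\nu,R,\sigma)$ (as defined in the context) and such that the given algebra structure on $W\otimes D\otimes V$ coincides with the iterated crossed product afforded by $Q$ (as defined in the context). More precisely, the map $Q$ is defined by $$Q(v\otimes w)=(1_W\otimes 1_D\otimes v)\cdot(w\otimes 1_D\otimes 1_V),\quad\text{for all } v\in V,\ w\in W.$$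
   Context: All vector spaces, algebras, linear maps and tensor products are over a fixed field $k$; "algebra" means associative unital algebra. Associativity of the tensor product of vector spaces is treated as an identity. Crossed product (Brzeziński). Let $(A,\mu,1_A)$ be an algebra, $V$ a vector space with a distinguished element $1_V\in V$, and $\sigma:V\otimes V\to A\otimes V$, $R:V\otimes A\to A\otimes V$ linear maps. One says that "we have a crossed product $A\otimes_{R,\sigma}V$" if for all $a\in A$, $v\in V$: - $R(1_V\otimes a)=a\otimes 1_V$ and $R(v\otimes 1_A)=1_A\otimes v$; - $\sigma(1_V\otimes v)=\sigma(v\otimes 1_V)=1_A\otimes v$; - $R\circ(id_V\otimes\mu)=(\mu\otimes id_V)\circ(id_A\otimes R)\circ(R\otimes id_A)$; - $(\mu\otimes id_V)\circ(id_A\otimes\sigma)\circ(R\otimes id_V)\circ(id_V\otimes\sigma)=(\mu\otimes id_V)\circ(id_A\otimes\sigma)\circ(\sigma\otimes id_V)$; - $(\mu\otimes id_V)\circ(id_A\otimes\sigma)\circ(R\otimes id_V)\circ(id_V\otimes R)=(\mu\otimes id_V)\circ(id_A\otimes R)\circ(\sigma\otimes id_A)$. In this case $A\otimes V$ is an associative algebra with unit $1_A\otimes 1_V$ and multiplication $(\mu_2\otimes id_V)\circ(id_A\otimes id_A\otimes\sigma)\circ(id_A\otimes R\otimes id_V)$, where $\mu_2=\mu\circ(id_A\otimes\mu)$; this algebra is denoted $A\otimes_{R,\sigma}V$. Mirror crossed product. Let $(B,\mu,1_B)$ be an algebra, $W$ a vector space with a distinguished element $1_W\in W$, and $\nu:W\otimes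 W\to W\otimes B$, $P:B\otimes W\to W\otimes B$ linear maps. One says that "we have a (mirror) crossed product $W\overline{\otimes}_{P,\nu}B$" if for all $b\in B$, $w\in W$: - $P(b\otimes 1_W)=1_W\otimes b$ and $P(1_B\otimes w)=w\otimes 1_B$; - $\nu(w\otimes 1_W)=\nu(1_W\otimes w)=w\otimes 1_B$; - $P\circ(\mu\otimes id_W)=(id_W\otimes\mu)\circ(P\otimes id_B)\circ(id_B\otimes P)$; - $(id_W\otimes\mu)\circ(\nu\otimes id_B)\circ(id_W\otimes P)\circ(\nu\otimes id_W)=(id_W\otimes\mu)\circ(\nu\otimes id_B)\circ(id_W\otimes\nu)$; - $(id_W\otimes\mu)\circ(\nu\otimes id_B)\circ(id_W\otimes P)\circ(P\otimes id_W)=(id_W\otimes\mu)\circ(P\otimes id_B)\circ(id_B\otimes\nu)$. In this case $W\otimes B$ is an associative algebra with unit $1_W\otimes 1_B$ and multiplication $(id_W\otimes\mu_2)\circ(\nu\otimes id_B\otimes id_B)\circ(id_W\otimes P\otimes id_B)$, where $\mu_2=\mu\circ(id_B\otimes\mu)$; this algebra is denoted $W\overline{\otimes}_{P,\nu}B$. Iteration map. Given a mirror crossed product $W\overline{\otimes}_{P,\nu}D$ and a crossed product $D\otimes_{R,\sigma}V$, we call a linear map $Q:V\otimes W\to W\otimes D\otimes V$ an iteration map for $(P,\nu,R,\sigma)$ if $Q(1_V\otimes w)=w\otimes 1_D\otimes 1_V$ and $Q(v\otimes 1_W)=1_W\otimes 1_D\otimes v$ for all $v\in V$, $w\in W$,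 and: (a) $(id_W\otimes\mu_D\otimes id_V)\circ(id_W\otimes id_D\otimes R)\circ(Q\otimes id_D)\circ(id_V\otimes P)=(id_W\otimes\mu_D\otimes id_V)\circ(P\otimes id_D\otimes id_V)\circ(id_D\otimes Q)\circ(R\otimes id_W)$; (b) $(id_W\otimes\mu_D\otimes id_V)\circ(id_W\otimes id_D\otimes R)\circ(Q\otimes id_D)\circ(id_V\otimes\nu)=(id_W\otimes\mu_D\otimes id_V)\circ(\nu\otimes\mu_D\otimes id_V)\circ(id_W\otimes P\otimes id_D\otimes id_V)\circ(id_W\otimes id_D\otimes Q)\circ(Q\otimes id_W)$; (c) $(id_W\otimes\mu_D\otimes id_V)\circ(P\otimes id_D\otimes id_V)\circ(id_D\otimes Q)\circ(\sigma\otimes id_W)=(id_W\otimes\mu_D\otimes id_V)\circ(id_W\otimes\mu_D\otimes\sigma)\circ(id_W\otimes id_D\otimes R\otimes id_V)\circ(Q\otimes id_D\otimes id_V)\circ(id_V\otimes Q)$. Iterated crossed product. For an iteration map $Q$, the iterated crossed product afforded by $Q$ is the algebra structure on $W\otimes D\otimes V$ given by the crossed product $(W\overline{\otimes}_{P,\nu}D)\otimes_{\overline{R},\overline{\sigma}}V$, where $\overline{\sigma}(v\otimes v')=1_W\otimes\sigma(v\otimes v')$ and $\overline{R}=(id_W\otimes\mu_D\otimes id_V)\circ(id_W\otimes id_D\otimes R)\circ(Q\otimes id_D)$; equivalently (via the trivial identification) by the mirror crossed product $W\overline{\otimes}_{\overline{P},\overline{\nu}}(D\otimes_{R,\sigma}V)$,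 where $\overline{\nu}(w\otimes w')=\nu(w\otimes w')\otimes 1_V$ and $\overline{P}=(id_W\otimes\mu_D\otimes id_V)\circ(P\otimes id_D\otimes id_V)\circ(id_D\otimes Q)$. Its unit is $1_W\otimes 1_D\otimes 1_V$. Explicitly, writing (with implicit summations) $P(d\otimes w)=w_P\otimes d_P$, $\nu(w\otimes w')=\nu_1(w,w')\otimes\nu_2(w,w')$, $R(v\otimes d)=d_R\otimes v_R$, $\sigma(v\otimes v')=\sigma_1(v,v')\otimes\sigma_2(v,v')$, $Q(v\otimes w)=Q_W(v,w)\otimes Q_D(v,w)\otimes Q_V(v,w)$, its multiplication is $$(w\otimes d\otimes v)(w'\otimes d'\otimes v')=\nu_1(w,Q_W(v,w')_P)\otimes\nu_2(w,Q_W(v,w')_P)\,d_P\,Q_D(v,w')\,d'_R\,\sigma_1(Q_V(v,w')_R,v')\otimes\sigma_2(Q_V(v,w')_R,v').$$ *)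

theory Defs
  imports "HOL-Algebra.Module" "HOL-Algebra.AbelCoset"
begin

text \<open>
  Vector spaces are modules (in the sense of HOL-Algebra) over a field \<open>K\<close>; the ring part
  \<open>mult\<close>, \<open>one\<close> of the record is irrelevant for a mere vector space.  The record of a tensor product
  additionally stores its two factors.  They have no influence on the space itself and only serve
  to insert the canonical associativity isomorphisms without having to name the factors each time.
\<close>

record ('k, 'a, 'm, 'n) tensor_module = "('k, 'a) module" +
  lfactor :: 'm
  rfactor :: 'n

type_synonym ('k, 'a, 'b) tensor = "('a \<times> 'b \<Rightarrow> 'k) set"

text \<open>
  A map together with its source and target spaces, normalised to \<open>undefined\<close> outside the carrier
  of the source, so that equality of arrows is equality of maps on the carrier.
\<close>

record ('a, 'b, 'm, 'n) arrow =
  source :: 'm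
  target :: 'n
  app :: "'a \<Rightarrow> 'b"

definition arrow_of ::
    "('k, 'a, 'm) module_scheme \<Rightarrow> ('k, 'b, 'n) module_scheme \<Rightarrow> ('a \<Rightarrow> 'b) \<Rightarrow>
      ('a, 'b, ('k, 'a, 'm) module_scheme, ('k, 'b, 'n) module_scheme) arrow"
  where "arrow_of M N f = \<lparr>source = M, target = N, app = restrict f (carrier M)\<rparr>"

definition ident ::
    "('k, 'a, 'm) module_scheme \<Rightarrow>
      ('a, 'a, ('k, 'a, 'm) module_scheme, ('k, 'a, 'm) module_scheme) arrow"
  where "ident M = arrow_of M M (\<lambda>x. x)"

definition comp_arrow (infixl "\<circ>\<^sub>a" 60)
  where "g \<circ>\<^sub>a f = arrow_of (source f) (target g) (\<lambda>x. app g (app f x))"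


context
  fixes K :: "('k, 'r) ring_scheme" (structure)
begin

definition linear_map ::
    "('k, 'a, 'm) module_scheme \<Rightarrow> ('k, 'b, 'n) module_scheme \<Rightarrow> ('a \<Rightarrow> 'b) \<Rightarrow> bool"
  where "linear_map M N f \<longleftrightarrow>
    f \<in> carrier M \<rightarrow> carrier N \<and>
    (\<forall>x\<in>carrier M. \<forall>y\<in>carrier M. f (x \<oplus>\<^bsub>M\<^esub> y) = f x \<oplus>\<^bsub>N\<^esub> f y) \<and>
    (\<forall>c\<in>carrier K. \<forall>x\<in>carrier M. f (c \<odot>\<^bsub>M\<^esub> x) = c \<odot>\<^bsub>N\<^esub> f x)"

text \<open>Associative unital, not necessarily commutative (unlike the locale \<open>algebra\<close>).\<close>

definition assoc_algebra :: "('k, 'a, 'm) module_scheme \<Rightarrow> bool"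
  where "assoc_algebra A \<longleftrightarrow> module K A \<and> ring A \<and>
    (\<forall>c\<in>carrier K. \<forall>x\<in>carrier A. \<forall>y\<in>carrier A.
       (c \<odot>\<^bsub>A\<^esub> x) \<otimes>\<^bsub>A\<^esub> y = c \<odot>\<^bsub>A\<^esub> (x \<otimes>\<^bsub>A\<^esub> y) \<and> x \<otimes>\<^bsub>A\<^esub> (c \<odot>\<^bsub>A\<^esub> y) = c \<odot>\<^bsub>A\<^esub> (x \<otimes>\<^bsub>A\<^esub> y))"

definition algebra_map ::
    "('k, 'a, 'm) module_scheme \<Rightarrow> ('k, 'b, 'n) module_scheme \<Rightarrow> ('a \<Rightarrow> 'b) \<Rightarrow> bool"
  where "algebra_map A B f \<longleftrightarrow> linear_map A B f \<and> f \<in> ring_hom A B"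

text \<open>Equality of algebra structures, ignoring the values of the operations outside the carrier.\<close>

definition same_algebra ::
    "('k, 'a, 'm) module_scheme \<Rightarrow> ('k, 'a, 'n) module_scheme \<Rightarrow> bool"
  where "same_algebra A B \<longleftrightarrow>
    carrier A = carrier B \<and> \<zero>\<^bsub>A\<^esub> = \<zero>\<^bsub>B\<^esub> \<and> \<one>\<^bsub>A\<^esub> = \<one>\<^bsub>B\<^esub> \<and>
    (\<forall>x\<in>carrier A. \<forall>y\<in>carrier A. x \<oplus>\<^bsub>A\<^esub> y = x \<oplus>\<^bsub>B\<^esub> y \<and> x \<otimes>\<^bsub>A\<^esub> y = x \<otimes>\<^bsub>B\<^esub> y) \<and>
    (\<forall>c\<in>carrier K. \<forall>x\<in>carrier A. c \<odot>\<^bsub>A\<^esub> x = c \<odot>\<^bsub>B\<^esub> x)"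


section \<open>Tensor products\<close>

definition free_module :: "'s set \<Rightarrow> ('k, 's \<Rightarrow> 'k) module"
  where "free_module S =
    \<lparr>carrier = {f. f ` S \<subseteq> carrier K \<and> (\<forall>s. s \<notin> S \<longrightarrow> f s = \<zero>) \<and> finite {s. f s \<noteq> \<zero>}},
     mult = undefined, one = undefined,
     zero = (\<lambda>s. \<zero>), add = (\<lambda>f g s. f s \<oplus> g s), smult = (\<lambda>c f s. c \<otimes> f s)\<rparr>"

definition single :: "'s \<Rightarrow> 's \<Rightarrow> 'k"
  where "single s = (\<lambda>t. if t = s then \<one> else \<zero>)"

definition span_of :: "('k, 'a, 'm) module_scheme \<Rightarrow> 'a set \<Rightarrow> 'a set"
  where "span_of M S = \<Inter> {H. submodule H K M \<and> S \<subseteq> H}"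

definition bilinear_relations ::
    "('k, 'a, 'm) module_scheme \<Rightarrow> ('k, 'b, 'n) module_scheme \<Rightarrow> ('a \<times> 'b \<Rightarrow> 'k) set"
  where "bilinear_relations M N =
    (let F = free_module (carrier M \<times> carrier N) in
     {single (x \<oplus>\<^bsub>M\<^esub> x', y) \<ominus>\<^bsub>F\<^esub> (single (x, y) \<oplus>\<^bsub>F\<^esub> single (x', y)) | x x' y.
        x \<in> carrier M \<and> x' \<in> carrier M \<and> y \<in> carrier N} \<union>
     {single (x, y \<oplus>\<^bsub>N\<^esub> y') \<ominus>\<^bsub>F\<^esub> (single (x, y) \<oplus>\<^bsub>F\<^esub> single (x, y')) | x y y'.
        x \<in> carrier M \<and> y \<in> carrier N \<and> y' \<in> carrier N} \<union>
     {single (c \<odot>\<^bsub>M\<^esub> x, y) \<ominus>\<^bsub>F\<^esub> (c \<odot>\<^bsub>F\<^esub> single (x, y)) | c x y.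
        c \<in> carrier K \<and> x \<in> carrier M \<and> y \<in> carrier N} \<union>
     {single (x, c \<odot>\<^bsub>N\<^esub> y) \<ominus>\<^bsub>F\<^esub> (c \<odot>\<^bsub>F\<^esub> single (x, y)) | c x y.
        c \<in> carrier K \<and> x \<in> carrier M \<and> y \<in> carrier N})"

text \<open>The quotient of the free module by the bilinear relations; its elements are cosets.\<close>

definition tensor_product ::
    "('k, 'a, 'm) module_scheme \<Rightarrow> ('k, 'b, 'n) module_scheme \<Rightarrow>
      ('k, ('k, 'a, 'b) tensor, ('k, 'a, 'm) module_scheme, ('k, 'b, 'n) module_scheme) tensor_module"
    (infixr "\<Otimes>" 80)
  where "M \<Otimes> N =
    (let F = free_module (carrier M \<times> carrier N); B = span_of F (bilinear_relations M N) in
     \<lparr>carrier = a_rcosets\<^bsub>F\<^esub> B,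
      mult = undefined, one = undefined,
      zero = B, add = (\<lambda>X Y. X <+>\<^bsub>F\<^esub> Y), smult = (\<lambda>c X. \<Union>f\<in>X. B +>\<^bsub>F\<^esub> (c \<odot>\<^bsub>F\<^esub> f)),
      lfactor = M, rfactor = N\<rparr>)"

definition tens ::
    "('k, 'a, 'm) module_scheme \<Rightarrow> ('k, 'b, 'n) module_scheme \<Rightarrow> 'a \<Rightarrow> 'b \<Rightarrow> ('k, 'a, 'b) tensor"
  where "tens M N x y =
    (let F = free_module (carrier M \<times> carrier N) in
     span_of F (bilinear_relations M N) +>\<^bsub>F\<^esub> single (x, y))"

definition tens3 ::
    "('k, 'a, 'm) module_scheme \<Rightarrow> ('k, 'b, 'n) module_scheme \<Rightarrow> ('k, 'c, 'p) module_scheme \<Rightarrow>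
      'a \<Rightarrow> 'b \<Rightarrow> 'c \<Rightarrow> ('k, 'a, ('k, 'b, 'c) tensor) tensor"
  where "tens3 M N L x y z = tens M (N \<Otimes> L) x (tens N L y z)"

text \<open>The unique linear map on \<open>M \<Otimes> N\<close> induced by a bilinear map \<open>\<beta>\<close> (universal property).\<close>

definition lift ::
    "('k, 'a, 'm) module_scheme \<Rightarrow> ('k, 'b, 'n) module_scheme \<Rightarrow> ('k, 'c, 'p) module_scheme \<Rightarrow>
      ('a \<Rightarrow> 'b \<Rightarrow> 'c) \<Rightarrow> ('k, 'a, 'b) tensor \<Rightarrow> 'c"
  where "lift M N L \<beta> =
    (THE h. h \<in> extensional (carrier (M \<Otimes> N)) \<and> linear_map (M \<Otimes> N) L h \<and>
       (\<forall>x\<in>carrier M. \<forall>y\<in>carrier N. h (tens M N x y) = \<beta> x y))"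

definition tensor_arrow (infixr "\<boxtimes>" 75)
  where "f \<boxtimes> g =
    arrow_of (source f \<Otimes> source g) (target f \<Otimes> target g)
      (lift (source f) (source g) (target f \<Otimes> target g)
        (\<lambda>x y. tens (target f) (target g) (app f x) (app g y)))"

definition assoc_right
  where "assoc_right M N L =
    arrow_of ((M \<Otimes> N) \<Otimes> L) (M \<Otimes> N \<Otimes> L)
      (lift (M \<Otimes> N) L (M \<Otimes> N \<Otimes> L)
        (\<lambda>t z. lift M N (M \<Otimes> N \<Otimes> L) (\<lambda>x y. tens M (N \<Otimes> L) x (tens N L y z)) t))"

definition assoc_left
  where "assoc_left M N L =
    arrow_of (M \<Otimes> N \<Otimes> L) ((M \<Otimes> N) \<Otimes> L)
      (lift M (N \<Otimes> L) ((M \<Otimes> N) \<Otimes> L)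
        (\<lambda>x t. lift N L ((M \<Otimes> N) \<Otimes> L) (\<lambda>y z. tens (M \<Otimes> N) L (tens M N x y) z) t))"

text \<open>
  Iterated tensor products are always bracketed to the right.  The operations below are \<open>f \<boxtimes> g\<close> up to
  this rebracketing, where the two indices are the numbers of tensor factors of the source and the
  target of \<open>f\<close>: for instance \<open>f : A \<Otimes> B \<rightarrow> C \<Otimes> D \<Otimes> E\<close> and \<open>g : X \<rightarrow> Y\<close> give
  \<open>f \<boxtimes>\<^sub>2\<^sub>3 g : A \<Otimes> B \<Otimes> X \<rightarrow> C \<Otimes> D \<Otimes> E \<Otimes> Y\<close>.
\<close>

definition tensor_arrow_21 (infixr "\<boxtimes>\<^sub>2\<^sub>1" 75)
  where "f \<boxtimes>\<^sub>2\<^sub>1 g =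
    (f \<boxtimes> g) \<circ>\<^sub>a assoc_left (lfactor (source f)) (rfactor (source f)) (source g)"

definition tensor_arrow_22 (infixr "\<boxtimes>\<^sub>2\<^sub>2" 75)
  where "f \<boxtimes>\<^sub>2\<^sub>2 g =
    assoc_right (lfactor (target f)) (rfactor (target f)) (target g) \<circ>\<^sub>a (f \<boxtimes>\<^sub>2\<^sub>1 g)"

definition tensor_arrow_23 (infixr "\<boxtimes>\<^sub>2\<^sub>3" 75)
  where "f \<boxtimes>\<^sub>2\<^sub>3 g =
    (ident (lfactor (target f)) \<boxtimes>
      assoc_right (lfactor (rfactor (target f))) (rfactor (rfactor (target f))) (target g)) \<circ>\<^sub>a
    (f \<boxtimes>\<^sub>2\<^sub>2 g)"

definition tensor_arrow_31 (infixr "\<boxtimes>\<^sub>3\<^sub>1" 75)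
  where "f \<boxtimes>\<^sub>3\<^sub>1 g =
    (f \<boxtimes>\<^sub>2\<^sub>1 g) \<circ>\<^sub>a
    (ident (lfactor (source f)) \<boxtimes>
      assoc_left (lfactor (rfactor (source f))) (rfactor (rfactor (source f))) (source g))"

definition mult_arrow
  where "mult_arrow A = arrow_of (A \<Otimes> A) A (lift A A A (\<lambda>a b. a \<otimes>\<^bsub>A\<^esub> b))"

definition mult2_arrow
  where "mult2_arrow A = mult_arrow A \<circ>\<^sub>a (ident A \<boxtimes> mult_arrow A)"


section \<open>Crossed products\<close>

definition crossed_product ::
    "('k, 'a, 'm) module_scheme \<Rightarrow> ('k, 'v, 'p) module_scheme \<Rightarrow> 'v \<Rightarrow>
      (('k, 'v, 'a) tensor \<Rightarrow> ('k, 'a, 'v) tensor) \<Rightarrow>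
      (('k, 'v, 'v) tensor \<Rightarrow> ('k, 'a, 'v) tensor) \<Rightarrow> bool"
  where "crossed_product A V oneV R \<sigma> \<longleftrightarrow>
    assoc_algebra A \<and> module K V \<and> oneV \<in> carrier V \<and>
    linear_map (V \<Otimes> A) (A \<Otimes> V) R \<and> linear_map (V \<Otimes> V) (A \<Otimes> V) \<sigma> \<and>
    (\<forall>a\<in>carrier A. R (tens V A oneV a) = tens A V a oneV) \<and>
    (\<forall>v\<in>carrier V. R (tens V A v \<one>\<^bsub>A\<^esub>) = tens A V \<one>\<^bsub>A\<^esub> v) \<and>
    (\<forall>v\<in>carrier V. \<sigma> (tens V V oneV v) = tens A V \<one>\<^bsub>A\<^esub> v) \<and>
    (\<forall>v\<in>carrier V. \<sigma> (tens V V v oneV) = tens A V \<one>\<^bsub>A\<^esub> v) \<and>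
    (let R = arrow_of (V \<Otimes> A) (A \<Otimes> V) R;
         \<sigma> = arrow_of (V \<Otimes> V) (A \<Otimes> V) \<sigma>;
         \<mu> = mult_arrow A
     in
       R \<circ>\<^sub>a (ident V \<boxtimes> \<mu>) =
         (\<mu> \<boxtimes>\<^sub>2\<^sub>1 ident V) \<circ>\<^sub>a (ident A \<boxtimes> R) \<circ>\<^sub>a (R \<boxtimes>\<^sub>2\<^sub>2 ident A) \<and>
       (\<mu> \<boxtimes>\<^sub>2\<^sub>1 ident V) \<circ>\<^sub>a (ident A \<boxtimes> \<sigma>) \<circ>\<^sub>a (R \<boxtimes>\<^sub>2\<^sub>2 ident V) \<circ>\<^sub>a (ident V \<boxtimes> \<sigma>) =
         (\<mu> \<boxtimes>\<^sub>2\<^sub>1 ident V) \<circ>\<^sub>a (ident A \<boxtimes> \<sigma>) \<circ>\<^sub>a (\<sigma> \<boxtimes>\<^sub>2\<^sub>2 ident V) \<and>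
       (\<mu> \<boxtimes>\<^sub>2\<^sub>1 ident V) \<circ>\<^sub>a (ident A \<boxtimes> \<sigma>) \<circ>\<^sub>a (R \<boxtimes>\<^sub>2\<^sub>2 ident V) \<circ>\<^sub>a (ident V \<boxtimes> R) =
         (\<mu> \<boxtimes>\<^sub>2\<^sub>1 ident V) \<circ>\<^sub>a (ident A \<boxtimes> R) \<circ>\<^sub>a (\<sigma> \<boxtimes>\<^sub>2\<^sub>2 ident A))"

definition crossed_algebra
  where "crossed_algebra A V oneV R \<sigma> =
    (let R = arrow_of (V \<Otimes> A) (A \<Otimes> V) R;
         \<sigma> = arrow_of (V \<Otimes> V) (A \<Otimes> V) \<sigma>;
         m = (mult2_arrow A \<boxtimes>\<^sub>3\<^sub>1 ident V) \<circ>\<^sub>a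
             (ident A \<boxtimes> ident A \<boxtimes> \<sigma>) \<circ>\<^sub>a
             (ident A \<boxtimes> (R \<boxtimes>\<^sub>2\<^sub>2 ident V)) \<circ>\<^sub>a
             assoc_right A V (A \<Otimes> V)
     in (A \<Otimes> V)\<lparr>mult := (\<lambda>x y. app m (tens (A \<Otimes> V) (A \<Otimes> V) x y)),
                  one := tens A V \<one>\<^bsub>A\<^esub> oneV\<rparr>)"

definition mirror_crossed_product ::
    "('k, 'w, 'p) module_scheme \<Rightarrow> 'w \<Rightarrow> ('k, 'b, 'm) module_scheme \<Rightarrow>
      (('k, 'b, 'w) tensor \<Rightarrow> ('k, 'w, 'b) tensor) \<Rightarrow>
      (('k, 'w, 'w) tensor \<Rightarrow> ('k, 'w, 'b) tensor) \<Rightarrow> bool"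
  where "mirror_crossed_product W oneW B P \<nu> \<longleftrightarrow>
    assoc_algebra B \<and> module K W \<and> oneW \<in> carrier W \<and>
    linear_map (B \<Otimes> W) (W \<Otimes> B) P \<and> linear_map (W \<Otimes> W) (W \<Otimes> B) \<nu> \<and>
    (\<forall>b\<in>carrier B. P (tens B W b oneW) = tens W B oneW b) \<and>
    (\<forall>w\<in>carrier W. P (tens B W \<one>\<^bsub>B\<^esub> w) = tens W B w \<one>\<^bsub>B\<^esub>) \<and>
    (\<forall>w\<in>carrier W. \<nu> (tens W W w oneW) = tens W B w \<one>\<^bsub>B\<^esub>) \<and>
    (\<forall>w\<in>carrier W. \<nu> (tens W W oneW w) = tens W B w \<one>\<^bsub>B\<^esub>) \<and>
    (let P = arrow_of (B \<Otimes> W) (W \<Otimes> B) P;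
         \<nu> = arrow_of (W \<Otimes> W) (W \<Otimes> B) \<nu>;
         \<mu> = mult_arrow B
     in
       P \<circ>\<^sub>a (\<mu> \<boxtimes>\<^sub>2\<^sub>1 ident W) =
         (ident W \<boxtimes> \<mu>) \<circ>\<^sub>a (P \<boxtimes>\<^sub>2\<^sub>2 ident B) \<circ>\<^sub>a (ident B \<boxtimes> P) \<and>
       (ident W \<boxtimes> \<mu>) \<circ>\<^sub>a (\<nu> \<boxtimes>\<^sub>2\<^sub>2 ident B) \<circ>\<^sub>a (ident W \<boxtimes> P) \<circ>\<^sub>a (\<nu> \<boxtimes>\<^sub>2\<^sub>2 ident W) =
         (ident W \<boxtimes> \<mu>) \<circ>\<^sub>a (\<nu> \<boxtimes>\<^sub>2\<^sub>2 ident B) \<circ>\<^sub>a (ident W \<boxtimes> \<nu>) \<and>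
       (ident W \<boxtimes> \<mu>) \<circ>\<^sub>a (\<nu> \<boxtimes>\<^sub>2\<^sub>2 ident B) \<circ>\<^sub>a (ident W \<boxtimes> P) \<circ>\<^sub>a (P \<boxtimes>\<^sub>2\<^sub>2 ident W) =
         (ident W \<boxtimes> \<mu>) \<circ>\<^sub>a (P \<boxtimes>\<^sub>2\<^sub>2 ident B) \<circ>\<^sub>a (ident B \<boxtimes> \<nu>))"

definition mirror_crossed_algebra
  where "mirror_crossed_algebra W oneW B P \<nu> =
    (let P = arrow_of (B \<Otimes> W) (W \<Otimes> B) P;
         \<nu> = arrow_of (W \<Otimes> W) (W \<Otimes> B) \<nu>;
         m = (ident W \<boxtimes> mult2_arrow B) \<circ>\<^sub>a
             (\<nu> \<boxtimes>\<^sub>2\<^sub>2 ident B \<boxtimes> ident B) \<circ>\<^sub>a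
             (ident W \<boxtimes> (P \<boxtimes>\<^sub>2\<^sub>2 ident B)) \<circ>\<^sub>a
             assoc_right W B (W \<Otimes> B)
     in (W \<Otimes> B)\<lparr>mult := (\<lambda>x y. app m (tens (W \<Otimes> B) (W \<Otimes> B) x y)),
                  one := tens W B oneW \<one>\<^bsub>B\<^esub>\<rparr>)"


section \<open>Iterated crossed products\<close>

definition iteration_map ::
    "('k, 'w, 'p) module_scheme \<Rightarrow> 'w \<Rightarrow> ('k, 'd, 'm) module_scheme \<Rightarrow>
      ('k, 'v, 'q) module_scheme \<Rightarrow> 'v \<Rightarrow>
      (('k, 'd, 'w) tensor \<Rightarrow> ('k, 'w, 'd) tensor) \<Rightarrow>
      (('k, 'w, 'w) tensor \<Rightarrow> ('k, 'w, 'd) tensor) \<Rightarrow>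
      (('k, 'v, 'd) tensor \<Rightarrow> ('k, 'd, 'v) tensor) \<Rightarrow>
      (('k, 'v, 'v) tensor \<Rightarrow> ('k, 'd, 'v) tensor) \<Rightarrow>
      (('k, 'v, 'w) tensor \<Rightarrow> ('k, 'w, ('k, 'd, 'v) tensor) tensor) \<Rightarrow> bool"
  where "iteration_map W oneW D V oneV P \<nu> R \<sigma> Q \<longleftrightarrow>
    linear_map (V \<Otimes> W) (W \<Otimes> D \<Otimes> V) Q \<and>
    (\<forall>w\<in>carrier W. Q (tens V W oneV w) = tens3 W D V w \<one>\<^bsub>D\<^esub> oneV) \<and>
    (\<forall>v\<in>carrier V. Q (tens V W v oneW) = tens3 W D V oneW \<one>\<^bsub>D\<^esub> v) \<and>
    (let P = arrow_of (D \<Otimes> W) (W \<Otimes> D) P;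
         \<nu> = arrow_of (W \<Otimes> W) (W \<Otimes> D) \<nu>;
         R = arrow_of (V \<Otimes> D) (D \<Otimes> V) R;
         \<sigma> = arrow_of (V \<Otimes> V) (D \<Otimes> V) \<sigma>;
         Q = arrow_of (V \<Otimes> W) (W \<Otimes> D \<Otimes> V) Q;
         \<mu> = mult_arrow D
     in
       (ident W \<boxtimes> (\<mu> \<boxtimes>\<^sub>2\<^sub>1 ident V)) \<circ>\<^sub>a (ident W \<boxtimes> ident D \<boxtimes> R) \<circ>\<^sub>a
           (Q \<boxtimes>\<^sub>2\<^sub>3 ident D) \<circ>\<^sub>a (ident V \<boxtimes> P) =
         (ident W \<boxtimes> (\<mu> \<boxtimes>\<^sub>2\<^sub>1 ident V)) \<circ>\<^sub>a (P \<boxtimes>\<^sub>2\<^sub>2 ident D \<boxtimes> ident V) \<circ>\<^sub>a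
           (ident D \<boxtimes> Q) \<circ>\<^sub>a (R \<boxtimes>\<^sub>2\<^sub>2 ident W) \<and>
       (ident W \<boxtimes> (\<mu> \<boxtimes>\<^sub>2\<^sub>1 ident V)) \<circ>\<^sub>a (ident W \<boxtimes> ident D \<boxtimes> R) \<circ>\<^sub>a
           (Q \<boxtimes>\<^sub>2\<^sub>3 ident D) \<circ>\<^sub>a (ident V \<boxtimes> \<nu>) =
         (ident W \<boxtimes> (\<mu> \<boxtimes>\<^sub>2\<^sub>1 ident V)) \<circ>\<^sub>a (\<nu> \<boxtimes>\<^sub>2\<^sub>2 (\<mu> \<boxtimes>\<^sub>2\<^sub>1 ident V)) \<circ>\<^sub>a
           (ident W \<boxtimes> (P \<boxtimes>\<^sub>2\<^sub>2 ident D \<boxtimes> ident V)) \<circ>\<^sub>a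
           (ident W \<boxtimes> ident D \<boxtimes> Q) \<circ>\<^sub>a (Q \<boxtimes>\<^sub>2\<^sub>3 ident W) \<and>
       (ident W \<boxtimes> (\<mu> \<boxtimes>\<^sub>2\<^sub>1 ident V)) \<circ>\<^sub>a (P \<boxtimes>\<^sub>2\<^sub>2 ident D \<boxtimes> ident V) \<circ>\<^sub>a
           (ident D \<boxtimes> Q) \<circ>\<^sub>a (\<sigma> \<boxtimes>\<^sub>2\<^sub>2 ident W) =
         (ident W \<boxtimes> (\<mu> \<boxtimes>\<^sub>2\<^sub>1 ident V)) \<circ>\<^sub>a (ident W \<boxtimes> (\<mu> \<boxtimes>\<^sub>2\<^sub>1 \<sigma>)) \<circ>\<^sub>a
           (ident W \<boxtimes> ident D \<boxtimes> (R \<boxtimes>\<^sub>2\<^sub>2 ident V)) \<circ>\<^sub>a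
           (Q \<boxtimes>\<^sub>2\<^sub>3 ident D \<boxtimes> ident V) \<circ>\<^sub>a (ident V \<boxtimes> Q))"

text \<open>
  The crossed product of the mirror crossed product algebra on \<open>W \<Otimes> D\<close> with \<open>V\<close>, transported along
  the canonical isomorphism from \<open>(W \<Otimes> D) \<Otimes> V\<close> to \<open>W \<Otimes> D \<Otimes> V\<close>.
\<close>

definition iterated_crossed_algebra
  where "iterated_crossed_algebra W oneW D V oneV P \<nu> R \<sigma> Q =
    (let A = mirror_crossed_algebra W oneW D P \<nu>;
         to_left = app (assoc_left W D V);
         to_right = app (assoc_right W D V);
         R' = (ident W \<boxtimes> (mult_arrow D \<boxtimes>\<^sub>2\<^sub>1 ident V)) \<circ>\<^sub>a
              (ident W \<boxtimes> ident D \<boxtimes> arrow_of (V \<Otimes> D) (D \<Otimes> V) R) \<circ>\<^sub>a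
              (arrow_of (V \<Otimes> W) (W \<Otimes> D \<Otimes> V) Q \<boxtimes>\<^sub>2\<^sub>3 ident D);
         Rbar = (\<lambda>t. to_left (app R' t));
         \<sigma>bar = (\<lambda>t. to_left (tens W (D \<Otimes> V) oneW (\<sigma> t)));
         C = crossed_algebra A V oneV Rbar \<sigma>bar
     in (W \<Otimes> D \<Otimes> V)\<lparr>mult := (\<lambda>x y. to_right (to_left x \<otimes>\<^bsub>C\<^esub> to_left y)),
                      one := to_right \<one>\<^bsub>C\<^esub>\<rparr>)"

end

notation tensor_product (infixr "\<Otimes>\<index>" 80)

end

theory Submission
  imports Defs
begin

text \<open>
  In \<open>E\<close>, write \<open>i w\<close>, \<open>j d\<close>, \<open>k v\<close> for the images of \<open>w\<close>, \<open>d\<close>, \<open>v\<close>, so that \<open>w \<otimes> d \<otimes> v = i w \<cdot> j d \<cdot> k v\<close>.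
  That the two inclusions are algebra maps says that \<open>P\<close>, \<open>\<nu>\<close>, \<open>R\<close>, \<open>\<sigma>\<close> and the multiplication of \<open>D\<close>
  rewrite a product such as \<open>k v \<cdot> j d\<close> without changing its value in \<open>E\<close>; the map \<open>Q\<close> does so
  for \<open>k v \<cdot> i w\<close> by its definition.  Value-preserving maps are closed under composition, tensor
  products and rebracketing, hence both sides of each axiom of an iteration map preserve values.
  As they end in \<open>W \<otimes> D \<otimes> V\<close>, where an element is its own value, they are equal.  The product of the
  iterated crossed product is a composite of the same maps, so it is the product of \<open>E\<close>.
\<close>

section \<open>The free module\<close>

text \<open>The source of the value preservation of \<open>P\<close>, \<open>\<nu>\<close>,
  \<open>R\<close> and \<open>\<sigma>\<close>: the crossed product multiplications return these
  maps as products of generators, for instance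
  \<open>(1 \<otimes> d)(w \<otimes> 1) = P(d \<otimes> w)\<close>, and the two inclusions are
  multiplicative. Since the images of these maps are not pure tensors, a calculation with elements
  would carry summation indices through every stage. Attaching to each space its linear map to
  \<open>E\<close> replaces that by pasting commutative triangles. The decomposition hypothesis
  makes the structure map of \<open>W \<Otimes> D \<Otimes> V\<close> the identity, hence injective,
  and this turns equality of values into equality of maps. The obstacle that shapes the rest: a
  tensor product record stores its factors, and an algebra on a space is that space with some fields
  replaced. So \<open>A \<Otimes> V\<close>, for the mirror algebra \<open>A\<close> on
  \<open>W \<Otimes> D\<close>, and \<open>(W \<Otimes> D) \<Otimes> V\<close> are different records
  with the same elements, and so are \<open>E\<close> and \<open>W \<Otimes> D \<Otimes> V\<close>.
  The relation \<open>same_space\<close> carries statements from one to the other.\<close>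

context
  fixes K :: "('k, 'r) ring_scheme" (structure)
begin

lemma mem_free_module:
  "f \<in> carrier (free_module K S) \<longleftrightarrow>
    (\<forall>s\<in>S. f s \<in> carrier K) \<and> (\<forall>s. s \<notin> S \<longrightarrow> f s = \<zero>) \<and> finite {s. f s \<noteq> \<zero>}"
  by (auto simp: free_module_def)

lemma free_module_simps:
  "f \<oplus>\<^bsub>free_module K S\<^esub> g = (\<lambda>s. f s \<oplus> g s)"
  "\<zero>\<^bsub>free_module K S\<^esub> = (\<lambda>s. \<zero>)"
  "c \<odot>\<^bsub>free_module K S\<^esub> f = (\<lambda>s. c \<otimes> f s)"
  by (auto simp: free_module_def)

lemma module_free_module:
  assumes "cring K"
  shows "module K (free_module K S)"
proof -
  interpret cring K by fact
  let ?F = "free_module K S"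
  have val: "f s \<in> carrier K" if "f \<in> carrier ?F" for f s
    using that by (cases "s \<in> S") (auto simp: mem_free_module)
  have add: "f \<oplus>\<^bsub>?F\<^esub> g \<in> carrier ?F" if "f \<in> carrier ?F" "g \<in> carrier ?F" for f g
  proof -
    have "{s. f s \<oplus> g s \<noteq> \<zero>} \<subseteq> {s. f s \<noteq> \<zero>} \<union> {s. g s \<noteq> \<zero>}"
      by (auto simp: val)
    then show ?thesis
      using that by (auto simp: mem_free_module free_module_simps intro: finite_subset)
  qed
  have smult: "c \<odot>\<^bsub>?F\<^esub> f \<in> carrier ?F" if "c \<in> carrier K" "f \<in> carrier ?F" for c f
  proof -
    have "{s. c \<otimes> f s \<noteq> \<zero>} \<subseteq> {s. f s \<noteq> \<zero>}"
      using that by auto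
    then show ?thesis
      using that by (auto simp: mem_free_module free_module_simps intro: finite_subset)
  qed
  have zero: "\<zero>\<^bsub>?F\<^esub> \<in> carrier ?F"
    by (simp add: mem_free_module free_module_simps)
  show ?thesis
  proof (rule moduleI)
    show "abelian_group ?F"
    proof (rule abelian_groupI)
      fix f assume f: "f \<in> carrier ?F"
      \<comment> \<open>The inverse is the multiple by \<open>\<ominus> \<one>\<close>, so its
        closure is an instance of \<open>smult\<close>.\<close>
      have "(\<ominus> \<one>) \<odot>\<^bsub>?F\<^esub> f \<oplus>\<^bsub>?F\<^esub> f = \<zero>\<^bsub>?F\<^esub>"
        using val[OF f] by (simp add: free_module_simps l_minus l_neg)
      then show "\<exists>g\<in>carrier ?F. g \<oplus>\<^bsub>?F\<^esub> f = \<zero>\<^bsub>?F\<^esub>"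
        using smult f by blast
    qed (use zero add val in \<open>auto simp: free_module_simps a_ac\<close>)
  qed (use smult val \<open>cring K\<close> in \<open>auto simp: free_module_simps l_distr r_distr m_assoc\<close>)
qed

lemma single_closed: "cring K \<Longrightarrow> s \<in> S \<Longrightarrow> single K s \<in> carrier (free_module K S)"
proof -
  assume "cring K" and "s \<in> S"
  interpret cring K by fact
  have "{t. single K s t \<noteq> \<zero>} \<subseteq> {s}"
    by (auto simp: single_def)
  then show ?thesis
    using \<open>s \<in> S\<close> by (auto simp: mem_free_module single_def intro: finite_subset)
qed

text \<open>Induction on the finite support: overwriting one nonzero value by zero splits off one
  scaled basis vector.\<close>

lemma free_module_induct:
  assumes "cring K" and f: "f \<in> carrier (free_module K S)"
    and zero: "P \<zero>\<^bsub>free_module K S\<^esub>"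
    and step: "\<And>g c s. g \<in> carrier (free_module K S) \<Longrightarrow> c \<in> carrier K \<Longrightarrow> s \<in> S \<Longrightarrow> P g \<Longrightarrow>
      P (c \<odot>\<^bsub>free_module K S\<^esub> single K s \<oplus>\<^bsub>free_module K S\<^esub> g)"
  shows "P f"
proof -
  interpret cring K by fact
  have "P f" if "finite A" "{s. f s \<noteq> \<zero>} = A" "f \<in> carrier (free_module K S)" for A f
    using that
  proof (induction A arbitrary: f rule: finite_induct)
    case empty
    then have "f = \<zero>\<^bsub>free_module K S\<^esub>"
      by (auto simp: free_module_simps)
    then show ?case
      using zero by simp
  next
    case (insert s A)
    define g where "g = f(s := \<zero>)"
    have supp: "{t. g t \<noteq> \<zero>} = A"
      using insert.prems insert.hyps by (auto simp: g_def)
    have g: "g \<in> carrier (free_module K S)"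
      using insert.prems supp insert.hyps by (auto simp: mem_free_module) (auto simp: g_def)
    have s: "s \<in> S" "f s \<in> carrier K"
      using insert.prems by (auto simp: mem_free_module)
    have val: "f t \<in> carrier K" for t
      using insert.prems(2) by (cases "t \<in> S") (auto simp: mem_free_module)
    have "f = f s \<odot>\<^bsub>free_module K S\<^esub> single K s \<oplus>\<^bsub>free_module K S\<^esub> g"
      by (auto simp: free_module_simps single_def g_def val)
    then show ?case
      using step[OF g s(2) s(1) insert.IH[OF supp g]] by simp
  qed
  then show ?thesis
    using f by (auto simp: mem_free_module)
qed

section \<open>Submodules and linear maps\<close>

lemma submodule_span_of:
  assumes "module K M" and "S \<subseteq> carrier M"
  shows "submodule (span_of K M S) K M"
proof -
  interpret module K M by fact
  \<comment> \<open>The family that is intersected must be nonempty; otherwise the span would be the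
    whole type instead of a subset of \<open>carrier M\<close>.\<close>
  have *: "carrier M \<in> {H. submodule H K M \<and> S \<subseteq> H}"
    using assms carrier_is_submodule by auto
  show ?thesis
  proof (rule submoduleI)
    show "span_of K M S \<subseteq> carrier M"
      using * unfolding span_of_def by blast
    show "\<zero>\<^bsub>M\<^esub> \<in> span_of K M S"
      unfolding span_of_def using submodule.axioms(1) subgroup.one_closed by fastforce
  qed (use submoduleE in \<open>auto simp: span_of_def\<close>)
qed

lemma span_of_superset: "S \<subseteq> span_of K M S"
  by (auto simp: span_of_def)

lemma span_of_least: "submodule H K M \<Longrightarrow> S \<subseteq> H \<Longrightarrow> span_of K M S \<subseteq> H"
  by (auto simp: span_of_def)

lemma linear_mapI:
  assumes "\<And>x. x \<in> carrier M \<Longrightarrow> f x \<in> carrier N"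
    and "\<And>x y. x \<in> carrier M \<Longrightarrow> y \<in> carrier M \<Longrightarrow> f (x \<oplus>\<^bsub>M\<^esub> y) = f x \<oplus>\<^bsub>N\<^esub> f y"
    and "\<And>c x. c \<in> carrier K \<Longrightarrow> x \<in> carrier M \<Longrightarrow> f (c \<odot>\<^bsub>M\<^esub> x) = c \<odot>\<^bsub>N\<^esub> f x"
  shows "linear_map K M N f"
  using assms by (auto simp: linear_map_def)

lemma linear_mapD:
  assumes "linear_map K M N f"
  shows "x \<in> carrier M \<Longrightarrow> f x \<in> carrier N"
    and "x \<in> carrier M \<Longrightarrow> y \<in> carrier M \<Longrightarrow> f (x \<oplus>\<^bsub>M\<^esub> y) = f x \<oplus>\<^bsub>N\<^esub> f y"
    and "c \<in> carrier K \<Longrightarrow> x \<in> carrier M \<Longrightarrow> f (c \<odot>\<^bsub>M\<^esub> x) = c \<odot>\<^bsub>N\<^esub> f x"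
  using assms by (auto simp: linear_map_def)

lemma linear_map_zero:
  assumes "module K M" "module K N" "linear_map K M N f"
  shows "f \<zero>\<^bsub>M\<^esub> = \<zero>\<^bsub>N\<^esub>"
proof -
  interpret M: module K M by fact
  interpret N: module K N by fact
  have "f (\<zero>\<^bsub>K\<^esub> \<odot>\<^bsub>M\<^esub> \<zero>\<^bsub>M\<^esub>) = \<zero>\<^bsub>K\<^esub> \<odot>\<^bsub>N\<^esub> f \<zero>\<^bsub>M\<^esub>"
    by (rule linear_mapD(3)[OF assms(3)]) auto
  then show ?thesis
    using linear_mapD(1)[OF assms(3)] by simp
qed

lemma linear_map_minus:
  assumes "module K M" "module K N" "linear_map K M N f" "x \<in> carrier M" "y \<in> carrier M"
  shows "f (x \<ominus>\<^bsub>M\<^esub> y) = f x \<ominus>\<^bsub>N\<^esub> f y"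
proof -
  interpret M: module K M by fact
  interpret N: module K N by fact
  have "f (\<ominus>\<^bsub>M\<^esub> y) = f ((\<ominus>\<^bsub>K\<^esub> \<one>\<^bsub>K\<^esub>) \<odot>\<^bsub>M\<^esub> y)"
    using assms by (simp add: M.smult_l_minus)
  also have "\<dots> = \<ominus>\<^bsub>N\<^esub> f y"
    using assms linear_mapD[OF assms(3)] by (simp add: N.smult_l_minus)
  finally show ?thesis
    using assms linear_mapD[OF assms(3)] by (simp add: M.minus_eq N.minus_eq)
qed

lemma linear_map_comp:
  assumes "linear_map K M N f" "linear_map K N L g"
  shows "linear_map K M L (\<lambda>x. g (f x))"
  using linear_mapD[OF assms(1)] linear_mapD[OF assms(2)] by (intro linear_mapI) auto

text \<open>Serves to kill a span: once the generators lie in a kernel, \<open>span_of_least\<close>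
  puts the whole span there.\<close>

lemma submodule_kernel:
  assumes "module K M" "module K N" "linear_map K M N f"
  shows "submodule {x \<in> carrier M. f x = \<zero>\<^bsub>N\<^esub>} K M"
proof -
  interpret M: module K M by fact
  interpret N: module K N by fact
  have "f (\<ominus>\<^bsub>M\<^esub> x) = \<zero>\<^bsub>N\<^esub>" if "x \<in> carrier M" "f x = \<zero>\<^bsub>N\<^esub>" for x
    using that linear_map_minus[OF assms M.zero_closed that(1)] linear_map_zero[OF assms]
    by (simp add: M.minus_eq N.minus_eq)
  then show ?thesis
    using linear_map_zero[OF assms] linear_mapD[OF assms(3)] by (intro M.submoduleI) auto
qed

lemma free_module_linear_eq:
  assumes "module K L" "linear_map K (free_module K S) L f" "linear_map K (free_module K S) L g"
    and "\<And>s. s \<in> S \<Longrightarrow> f (single K s) = g (single K s)"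
    and "x \<in> carrier (free_module K S)"
  shows "f x = g x"
proof -
  interpret L: module K L by fact
  interpret F: module K "free_module K S" by (rule module_free_module) (rule L.is_cring)
  show ?thesis
    using assms(5)
  proof (induction x rule: free_module_induct[OF L.is_cring, consumes 1, case_names zero step])
    case zero
    then show ?case
      by (simp add: linear_map_zero[OF F.module_axioms assms(1)] assms(2,3))
  next
    case (step x c s)
    have "single K s \<in> carrier (free_module K S)"
      by (rule single_closed[OF L.is_cring step(3)])
    then show ?case
      using step assms(4)[OF step(3)] linear_mapD[OF assms(2)] linear_mapD[OF assms(3)] by simp
  qed
qed

section \<open>Linear extension from basis vectors: the universal property of the free
  module\<close>

definition free_lift :: "('k, 'a, 'm) module_scheme \<Rightarrow> ('s \<Rightarrow> 'a) \<Rightarrow> ('s \<Rightarrow> 'k) \<Rightarrow> 'a"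
  where "free_lift L b f = (\<Oplus>\<^bsub>L\<^esub>s\<in>{s. f s \<noteq> \<zero>}. f s \<odot>\<^bsub>L\<^esub> b s)"

text \<open>Additivity compares sums over the supports of \<open>f\<close>, \<open>g\<close> and
  their sum, which differ because of cancellation. Padding with zero terms brings them all to one
  finite index set.\<close>

lemma free_lift_superset:
  assumes "module K L" "\<And>s. s \<in> S \<Longrightarrow> b s \<in> carrier L" "f \<in> carrier (free_module K S)"
    and "finite A" "{s. f s \<noteq> \<zero>} \<subseteq> A" "A \<subseteq> S"
  shows "free_lift L b f = (\<Oplus>\<^bsub>L\<^esub>s\<in>A. f s \<odot>\<^bsub>L\<^esub> b s)"
proof -
  interpret L: module K L by fact
  show ?thesis
    unfolding free_lift_def
    using assms by (intro L.add.finprod_mono_neutral_cong_left) (auto simp: mem_free_module subset_iff)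
qed

lemma linear_map_free_lift:
  assumes L: "module K L" and b: "\<And>s. s \<in> S \<Longrightarrow> b s \<in> carrier L"
  shows "linear_map K (free_module K S) L (free_lift L b)"
proof -
  interpret L: module K L by fact
  interpret F: module K "free_module K S" by (rule module_free_module) (rule L.is_cring)
  have supp: "{s. f s \<noteq> \<zero>} \<subseteq> S" "finite {s. f s \<noteq> \<zero>}" and val: "\<And>s. s \<in> S \<Longrightarrow> f s \<in> carrier K"
    if "f \<in> carrier (free_module K S)" for f
    using that by (auto simp: mem_free_module)
  show ?thesis
  proof (rule linear_mapI)
    fix f assume f: "f \<in> carrier (free_module K S)"
    show "free_lift L b f \<in> carrier L"
      unfolding free_lift_def using supp[OF f] val[OF f] b by (intro L.finsum_closed) auto
  next
    fix f g assume f: "f \<in> carrier (free_module K S)" and g: "g \<in> carrier (free_module K S)"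
    let ?A = "{s. f s \<noteq> \<zero>} \<union> {s. g s \<noteq> \<zero>}"
    let ?h = "f \<oplus>\<^bsub>free_module K S\<^esub> g"
    have A: "finite ?A" "?A \<subseteq> S"
      using supp f g by blast+
    have "{s. ?h s \<noteq> \<zero>} \<subseteq> ?A"
      by (auto simp: free_module_simps)
    then have "free_lift L b ?h = (\<Oplus>\<^bsub>L\<^esub>s\<in>?A. ?h s \<odot>\<^bsub>L\<^esub> b s)"
      using A f g by (intro free_lift_superset[OF L b]) auto
    also have "\<dots> = (\<Oplus>\<^bsub>L\<^esub>s\<in>?A. f s \<odot>\<^bsub>L\<^esub> b s \<oplus>\<^bsub>L\<^esub> g s \<odot>\<^bsub>L\<^esub> b s)"
    proof (rule L.finsum_cong')
      fix s assume "s \<in> ?A"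
      then have "s \<in> S" using A by blast
      then show "?h s \<odot>\<^bsub>L\<^esub> b s = f s \<odot>\<^bsub>L\<^esub> b s \<oplus>\<^bsub>L\<^esub> g s \<odot>\<^bsub>L\<^esub> b s"
        using val[OF f] val[OF g] b by (auto simp: free_module_simps L.smult_l_distr)
    qed (use A val[OF f] val[OF g] b in auto)
    also have "\<dots> = (\<Oplus>\<^bsub>L\<^esub>s\<in>?A. f s \<odot>\<^bsub>L\<^esub> b s) \<oplus>\<^bsub>L\<^esub> (\<Oplus>\<^bsub>L\<^esub>s\<in>?A. g s \<odot>\<^bsub>L\<^esub> b s)"
      using A val[OF f] val[OF g] b by (intro L.finsum_addf) auto
    also have "\<dots> = free_lift L b f \<oplus>\<^bsub>L\<^esub> free_lift L b g"
      using A f g by (simp add: free_lift_superset[OF L b _ A(1) _ A(2)])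
    finally show "free_lift L b ?h = free_lift L b f \<oplus>\<^bsub>L\<^esub> free_lift L b g" .
  next
    fix c f assume c: "c \<in> carrier K" and f: "f \<in> carrier (free_module K S)"
    let ?A = "{s. f s \<noteq> \<zero>}"
    let ?h = "c \<odot>\<^bsub>free_module K S\<^esub> f"
    have A: "finite ?A" "?A \<subseteq> S"
      using supp f by blast+
    have "{s. ?h s \<noteq> \<zero>} \<subseteq> ?A"
      using c by (auto simp: free_module_simps)
    then have "free_lift L b ?h = (\<Oplus>\<^bsub>L\<^esub>s\<in>?A. ?h s \<odot>\<^bsub>L\<^esub> b s)"
      using A c f by (intro free_lift_superset[OF L b]) auto
    also have "\<dots> = (\<Oplus>\<^bsub>L\<^esub>s\<in>?A. c \<odot>\<^bsub>L\<^esub> (f s \<odot>\<^bsub>L\<^esub> b s))"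
    proof (rule L.finsum_cong')
      fix s assume "s \<in> ?A"
      then have "s \<in> S" using A by blast
      then show "?h s \<odot>\<^bsub>L\<^esub> b s = c \<odot>\<^bsub>L\<^esub> (f s \<odot>\<^bsub>L\<^esub> b s)"
        using val[OF f] c b by (auto simp: free_module_simps L.smult_assoc1)
    qed (use A val[OF f] c b in auto)
    also have "\<dots> = c \<odot>\<^bsub>L\<^esub> free_lift L b f"
      unfolding free_lift_def using A val[OF f] c b
      by (intro L.finsum_smult_ldistr[symmetric]) auto
    finally show "free_lift L b ?h = c \<odot>\<^bsub>L\<^esub> free_lift L b f" .
  qed
qed

lemma free_lift_single:
  assumes "module K L" "\<And>s. s \<in> S \<Longrightarrow> b s \<in> carrier L" "s \<in> S"
  shows "free_lift L b (single K s) = b s"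
proof -
  interpret L: module K L by fact
  have "free_lift L b (single K s) = (\<Oplus>\<^bsub>L\<^esub>t\<in>{s}. single K s t \<odot>\<^bsub>L\<^esub> b t)"
    using assms by (intro free_lift_superset single_closed L.is_cring) (auto simp: single_def)
  also have "\<dots> = b s"
    using assms by (auto simp: single_def Pi_iff)
  finally show ?thesis .
qed

end

section \<open>Tensor products\<close>

definition bilinear_map ::
    "('k, 'r) ring_scheme \<Rightarrow> ('k, 'a, 'm) module_scheme \<Rightarrow> ('k, 'b, 'n) module_scheme \<Rightarrow>
      ('k, 'c, 'p) module_scheme \<Rightarrow> ('a \<Rightarrow> 'b \<Rightarrow> 'c) \<Rightarrow> bool"
  where "bilinear_map K M N L \<beta> \<longleftrightarrow>
    (\<forall>x\<in>carrier M. linear_map K N L (\<beta> x)) \<and> (\<forall>y\<in>carrier N. linear_map K M L (\<lambda>x. \<beta> x y))"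

lemma bilinear_mapI:
  assumes "\<And>x. x \<in> carrier M \<Longrightarrow> linear_map K N L (\<beta> x)"
    and "\<And>y. y \<in> carrier N \<Longrightarrow> linear_map K M L (\<lambda>x. \<beta> x y)"
  shows "bilinear_map K M N L \<beta>"
  using assms by (simp add: bilinear_map_def)

context
  fixes K :: "('k, 'r) ring_scheme" (structure)
begin

lemma bilinear_mapD:
  assumes "bilinear_map K M N L \<beta>" "x \<in> carrier M" "y \<in> carrier N"
  shows "\<beta> x y \<in> carrier L"
    and "x' \<in> carrier M \<Longrightarrow> \<beta> (x \<oplus>\<^bsub>M\<^esub> x') y = \<beta> x y \<oplus>\<^bsub>L\<^esub> \<beta> x' y"
    and "y' \<in> carrier N \<Longrightarrow> \<beta> x (y \<oplus>\<^bsub>N\<^esub> y') = \<beta> x y \<oplus>\<^bsub>L\<^esub> \<beta> x y'"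
    and "c \<in> carrier K \<Longrightarrow> \<beta> (c \<odot>\<^bsub>M\<^esub> x) y = c \<odot>\<^bsub>L\<^esub> \<beta> x y"
    and "c \<in> carrier K \<Longrightarrow> \<beta> x (c \<odot>\<^bsub>N\<^esub> y) = c \<odot>\<^bsub>L\<^esub> \<beta> x y"
  using assms linear_mapD[of K N L "\<beta> x"] linear_mapD[of K M L "\<lambda>x. \<beta> x y"]
  by (auto simp: bilinear_map_def)

text \<open>The quotient map in terms of representatives. Calculations in the tensor product become
  calculations with functions in the free module, and \<open>tens\<close> is its restriction to
  basis vectors.\<close>

definition tensor_proj ::
    "('k, 'a, 'm) module_scheme \<Rightarrow> ('k, 'b, 'n) module_scheme \<Rightarrow> ('a \<times> 'b \<Rightarrow> 'k) \<Rightarrow> ('k, 'a, 'b) tensor"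
  where "tensor_proj M N f =
    span_of K (free_module K (carrier M \<times> carrier N)) (bilinear_relations K M N)
      +>\<^bsub>free_module K (carrier M \<times> carrier N)\<^esub> f"

lemma tens_eq_proj: "tens K M N x y = tensor_proj M N (single K (x, y))"
  by (simp add: tens_def tensor_proj_def Let_def)

context
  fixes M :: "('k, 'a, 'm) module_scheme" and N :: "('k, 'b, 'n) module_scheme"
  assumes M: "module K M" and N: "module K N"
begin

interpretation M: module K M by (rule M)
interpretation N: module K N by (rule N)

abbreviation (input) "FMN \<equiv> free_module K (carrier M \<times> carrier N)"
abbreviation (input) "BMN \<equiv> span_of K FMN (bilinear_relations K M N)"

interpretation F: module K FMN
  by (rule module_free_module) (rule M.is_cring)

lemma bilinear_relations_closed: "bilinear_relations K M N \<subseteq> carrier FMN"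
proof -
  have "single K (x, y) \<in> carrier FMN" if "x \<in> carrier M" "y \<in> carrier N" for x y
    using that by (intro single_closed M.is_cring) auto
  then show ?thesis
    by (auto simp: bilinear_relations_def Let_def)
qed

lemma submodule_relations: "submodule BMN K FMN"
  by (rule submodule_span_of[OF F.module_axioms bilinear_relations_closed])

interpretation B: submodule BMN K FMN
  by (rule submodule_relations)

interpretation B: abelian_subgroup BMN FMN
  by (rule abelian_subgroupI3) (auto intro: additive_subgroup.intro B.subgroup_axioms F.abelian_group_axioms)

lemma tensor_proj_eq_iff:
  assumes "f \<in> carrier FMN" "g \<in> carrier FMN"
  shows "tensor_proj M N f = tensor_proj M N g \<longleftrightarrow> f \<ominus>\<^bsub>FMN\<^esub> g \<in> BMN"
proof -
  have "f \<ominus>\<^bsub>FMN\<^esub> g \<in> BMN \<longleftrightarrow> f \<in> BMN +>\<^bsub>FMN\<^esub> g"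
    using B.a_rcos_module[OF assms(2,1)] by (simp only: F.minus_eq)
  moreover have "f \<in> BMN +>\<^bsub>FMN\<^esub> g \<longleftrightarrow> BMN +>\<^bsub>FMN\<^esub> f = BMN +>\<^bsub>FMN\<^esub> g"
    using B.a_repr_independence'[OF _ assms(2), of f] B.a_rcos_self[OF assms(1)] by (auto simp only:)
  ultimately show ?thesis
    by (simp only: tensor_proj_def)
qed

lemma carrier_tensor: "carrier (M \<Otimes> N) = tensor_proj M N ` carrier FMN"
  by (auto simp: tensor_product_def Let_def A_RCOSETS_def RCOSETS_def tensor_proj_def a_r_coset_def)

lemma zero_tensor: "\<zero>\<^bsub>M \<Otimes> N\<^esub> = tensor_proj M N \<zero>\<^bsub>FMN\<^esub>"
  using F.a_coset_add_zero[OF B.a_subset] by (simp add: tensor_product_def Let_def tensor_proj_def)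

lemma add_tensor:
  "f \<in> carrier FMN \<Longrightarrow> g \<in> carrier FMN \<Longrightarrow>
    tensor_proj M N f \<oplus>\<^bsub>M \<Otimes> N\<^esub> tensor_proj M N g = tensor_proj M N (f \<oplus>\<^bsub>FMN\<^esub> g)"
  by (simp add: tensor_product_def Let_def tensor_proj_def B.a_rcos_sum)

text \<open>The scalar multiple of a coset is defined as a union over all its representatives. Each
  of them contributes the same coset, because the relations are closed under scalars, and the union
  is not empty, because \<open>f\<close> lies in its own coset.\<close>

lemma smult_tensor:
  assumes c: "c \<in> carrier K" and f: "f \<in> carrier FMN"
  shows "c \<odot>\<^bsub>M \<Otimes> N\<^esub> tensor_proj M N f = tensor_proj M N (c \<odot>\<^bsub>FMN\<^esub> f)"
proof -
  have "tensor_proj M N (c \<odot>\<^bsub>FMN\<^esub> g) = tensor_proj M N (c \<odot>\<^bsub>FMN\<^esub> f)"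
    if g: "g \<in> tensor_proj M N f" for g
  proof -
    have gF: "g \<in> carrier FMN"
      using B.a_elemrcos_carrier[OF f] g by (simp add: tensor_proj_def)
    have "g \<ominus>\<^bsub>FMN\<^esub> f \<in> BMN"
      using B.a_rcos_module_imp[OF f] g by (simp add: tensor_proj_def F.minus_eq)
    then have "c \<odot>\<^bsub>FMN\<^esub> (g \<ominus>\<^bsub>FMN\<^esub> f) \<in> BMN"
      using c by (rule B.smult_closed[rotated])
    then have "c \<odot>\<^bsub>FMN\<^esub> g \<ominus>\<^bsub>FMN\<^esub> c \<odot>\<^bsub>FMN\<^esub> f \<in> BMN"
      using c f gF by (simp add: F.minus_eq F.smult_r_distr F.smult_r_minus)
    then show ?thesis
      using c f gF by (subst tensor_proj_eq_iff) auto
  qed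
  moreover have "f \<in> tensor_proj M N f"
    using B.a_rcos_self[OF f] by (simp add: tensor_proj_def)
  ultimately have "(\<Union>g\<in>tensor_proj M N f. tensor_proj M N (c \<odot>\<^bsub>FMN\<^esub> g)) =
      tensor_proj M N (c \<odot>\<^bsub>FMN\<^esub> f)"
    by blast
  then show ?thesis
    by (simp add: tensor_product_def Let_def tensor_proj_def)
qed

lemma tensor_rep:
  assumes "X \<in> carrier (M \<Otimes> N)"
  obtains f where "f \<in> carrier FMN" "X = tensor_proj M N f"
  using assms by (auto simp: carrier_tensor)

lemma tensor_proj_closed: "f \<in> carrier FMN \<Longrightarrow> tensor_proj M N f \<in> carrier (M \<Otimes> N)"
  by (simp add: carrier_tensor)

lemma module_tensor: "module K (M \<Otimes> N)"
proof (rule moduleI)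
  show "cring K" by (rule M.is_cring)
  show "abelian_group (M \<Otimes> N)"
  proof (rule abelian_groupI)
    show "\<zero>\<^bsub>M \<Otimes> N\<^esub> \<in> carrier (M \<Otimes> N)"
      by (simp add: zero_tensor tensor_proj_closed)
  next
    fix X assume "X \<in> carrier (M \<Otimes> N)"
    then obtain f where f: "f \<in> carrier FMN" "X = tensor_proj M N f"
      by (rule tensor_rep)
    then have "tensor_proj M N (\<ominus>\<^bsub>FMN\<^esub> f) \<oplus>\<^bsub>M \<Otimes> N\<^esub> X = \<zero>\<^bsub>M \<Otimes> N\<^esub>"
      by (simp add: add_tensor zero_tensor F.l_neg)
    then show "\<exists>Y\<in>carrier (M \<Otimes> N). Y \<oplus>\<^bsub>M \<Otimes> N\<^esub> X = \<zero>\<^bsub>M \<Otimes> N\<^esub>"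
      using tensor_proj_closed[OF F.a_inv_closed[OF f(1)]] by blast
    show "\<zero>\<^bsub>M \<Otimes> N\<^esub> \<oplus>\<^bsub>M \<Otimes> N\<^esub> X = X"
      using f by (simp add: add_tensor zero_tensor)
    fix Y assume "Y \<in> carrier (M \<Otimes> N)"
    then obtain g where g: "g \<in> carrier FMN" "Y = tensor_proj M N g"
      by (rule tensor_rep)
    show "X \<oplus>\<^bsub>M \<Otimes> N\<^esub> Y \<in> carrier (M \<Otimes> N)"
      using f g by (simp add: add_tensor tensor_proj_closed)
    show "X \<oplus>\<^bsub>M \<Otimes> N\<^esub> Y = Y \<oplus>\<^bsub>M \<Otimes> N\<^esub> X"
      using f g by (simp add: add_tensor F.a_comm)
    fix Z assume "Z \<in> carrier (M \<Otimes> N)"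
    then obtain h where h: "h \<in> carrier FMN" "Z = tensor_proj M N h"
      by (rule tensor_rep)
    show "X \<oplus>\<^bsub>M \<Otimes> N\<^esub> Y \<oplus>\<^bsub>M \<Otimes> N\<^esub> Z = X \<oplus>\<^bsub>M \<Otimes> N\<^esub> (Y \<oplus>\<^bsub>M \<Otimes> N\<^esub> Z)"
      using f g h by (simp add: add_tensor F.a_assoc)
  qed
next
  fix a b X assume ab: "a \<in> carrier K" "b \<in> carrier K" and "X \<in> carrier (M \<Otimes> N)"
  then obtain f where f: "f \<in> carrier FMN" "X = tensor_proj M N f"
    using tensor_rep by blast
  show "a \<odot>\<^bsub>M \<Otimes> N\<^esub> X \<in> carrier (M \<Otimes> N)"
    using f ab by (simp add: smult_tensor tensor_proj_closed)
  show "(a \<oplus> b) \<odot>\<^bsub>M \<Otimes> N\<^esub> X = a \<odot>\<^bsub>M \<Otimes> N\<^esub> X \<oplus>\<^bsub>M \<Otimes> N\<^esub> b \<odot>\<^bsub>M \<Otimes> N\<^esub> X"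
    using f ab by (simp add: smult_tensor add_tensor F.smult_l_distr)
  show "(a \<otimes> b) \<odot>\<^bsub>M \<Otimes> N\<^esub> X = a \<odot>\<^bsub>M \<Otimes> N\<^esub> (b \<odot>\<^bsub>M \<Otimes> N\<^esub> X)"
    using f ab by (simp add: smult_tensor F.smult_assoc1)
next
  fix X assume "X \<in> carrier (M \<Otimes> N)"
  then show "\<one> \<odot>\<^bsub>M \<Otimes> N\<^esub> X = X"
    by (rule tensor_rep) (simp add: smult_tensor)
next
  fix a X Y assume a: "a \<in> carrier K" and "X \<in> carrier (M \<Otimes> N)" "Y \<in> carrier (M \<Otimes> N)"
  then obtain f g where "f \<in> carrier FMN" "X = tensor_proj M N f"
    and "g \<in> carrier FMN" "Y = tensor_proj M N g"
    using tensor_rep by metis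
  with a show "a \<odot>\<^bsub>M \<Otimes> N\<^esub> (X \<oplus>\<^bsub>M \<Otimes> N\<^esub> Y) = a \<odot>\<^bsub>M \<Otimes> N\<^esub> X \<oplus>\<^bsub>M \<Otimes> N\<^esub> a \<odot>\<^bsub>M \<Otimes> N\<^esub> Y"
    by (simp add: smult_tensor add_tensor F.smult_r_distr)
qed

section \<open>Bilinearity of pure tensors and the universal property of the tensor product\<close>

interpretation T: module K "M \<Otimes> N" by (rule module_tensor)

lemma linear_map_tensor_proj: "linear_map K FMN (M \<Otimes> N) (tensor_proj M N)"
  by (rule linear_mapI) (auto simp: carrier_tensor smult_tensor add_tensor)

lemma bilinear_tens: "bilinear_map K M N (M \<Otimes> N) (tens K M N)"
proof -
  have sc: "single K (x, y) \<in> carrier FMN" if "x \<in> carrier M" "y \<in> carrier N" for x y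
    using that by (intro single_closed M.is_cring) auto
  \<comment> \<open>Each of the four laws below is one of the four families of generating relations,
    read modulo their span.\<close>
  have rel: "tensor_proj M N f = tensor_proj M N g"
    if "f \<ominus>\<^bsub>FMN\<^esub> g \<in> bilinear_relations K M N" "f \<in> carrier FMN" "g \<in> carrier FMN" for f g
    using that span_of_superset[of "bilinear_relations K M N" K FMN]
    by (subst tensor_proj_eq_iff) auto
  show ?thesis
  proof (intro bilinear_mapI linear_mapI)
    fix x y y' assume *: "x \<in> carrier M" "y \<in> carrier N" "y' \<in> carrier N"
    have "tens K M N x (y \<oplus>\<^bsub>N\<^esub> y') =
        tensor_proj M N (single K (x, y) \<oplus>\<^bsub>FMN\<^esub> single K (x, y'))"
      unfolding tens_eq_proj
    proof (rule rel)
      show "single K (x, y \<oplus>\<^bsub>N\<^esub> y') \<ominus>\<^bsub>FMN\<^esub> (single K (x, y) \<oplus>\<^bsub>FMN\<^esub> single K (x, y'))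
          \<in> bilinear_relations K M N"
        using * unfolding bilinear_relations_def Let_def by blast
    qed (use * sc in auto)
    then show "tens K M N x (y \<oplus>\<^bsub>N\<^esub> y') = tens K M N x y \<oplus>\<^bsub>M \<Otimes> N\<^esub> tens K M N x y'"
      using * sc by (simp add: tens_eq_proj add_tensor)
  next
    fix x x' y assume *: "x \<in> carrier M" "x' \<in> carrier M" "y \<in> carrier N"
    have "tens K M N (x \<oplus>\<^bsub>M\<^esub> x') y =
        tensor_proj M N (single K (x, y) \<oplus>\<^bsub>FMN\<^esub> single K (x', y))"
      unfolding tens_eq_proj
    proof (rule rel)
      show "single K (x \<oplus>\<^bsub>M\<^esub> x', y) \<ominus>\<^bsub>FMN\<^esub> (single K (x, y) \<oplus>\<^bsub>FMN\<^esub> single K (x', y))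
          \<in> bilinear_relations K M N"
        using * unfolding bilinear_relations_def Let_def by blast
    qed (use * sc in auto)
    then show "tens K M N (x \<oplus>\<^bsub>M\<^esub> x') y = tens K M N x y \<oplus>\<^bsub>M \<Otimes> N\<^esub> tens K M N x' y"
      using * sc by (simp add: tens_eq_proj add_tensor)
  next
    fix c x y assume *: "c \<in> carrier K" "x \<in> carrier M" "y \<in> carrier N"
    have "tens K M N (c \<odot>\<^bsub>M\<^esub> x) y = tensor_proj M N (c \<odot>\<^bsub>FMN\<^esub> single K (x, y))"
      unfolding tens_eq_proj
    proof (rule rel)
      show "single K (c \<odot>\<^bsub>M\<^esub> x, y) \<ominus>\<^bsub>FMN\<^esub> (c \<odot>\<^bsub>FMN\<^esub> single K (x, y))
          \<in> bilinear_relations K M N"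
        using * unfolding bilinear_relations_def Let_def by blast
    qed (use * sc in auto)
    then show "tens K M N (c \<odot>\<^bsub>M\<^esub> x) y = c \<odot>\<^bsub>M \<Otimes> N\<^esub> tens K M N x y"
      using * sc by (simp add: tens_eq_proj smult_tensor)
  next
    fix c x y assume *: "c \<in> carrier K" "x \<in> carrier M" "y \<in> carrier N"
    have "tens K M N x (c \<odot>\<^bsub>N\<^esub> y) = tensor_proj M N (c \<odot>\<^bsub>FMN\<^esub> single K (x, y))"
      unfolding tens_eq_proj
    proof (rule rel)
      show "single K (x, c \<odot>\<^bsub>N\<^esub> y) \<ominus>\<^bsub>FMN\<^esub> (c \<odot>\<^bsub>FMN\<^esub> single K (x, y))
          \<in> bilinear_relations K M N"
        using * unfolding bilinear_relations_def Let_def by blast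
    qed (use * sc in auto)
    then show "tens K M N x (c \<odot>\<^bsub>N\<^esub> y) = c \<odot>\<^bsub>M \<Otimes> N\<^esub> tens K M N x y"
      using * sc by (simp add: tens_eq_proj smult_tensor)
  qed (use sc in \<open>auto simp: tens_eq_proj carrier_tensor\<close>)
qed

text \<open>Both maps are pulled back to the free module, where the pure tensors come from the basis
  vectors. Nearly every later identity between tensors is reduced to pure tensors by this
  rule.\<close>

lemma tensor_linear_eq:
  assumes L: "module K L" and fg: "linear_map K (M \<Otimes> N) L f" "linear_map K (M \<Otimes> N) L g"
    and eq: "\<And>x y. x \<in> carrier M \<Longrightarrow> y \<in> carrier N \<Longrightarrow> f (tens K M N x y) = g (tens K M N x y)"
    and t: "t \<in> carrier (M \<Otimes> N)"
  shows "f t = g t"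
proof -
  obtain h where h: "h \<in> carrier FMN" "t = tensor_proj M N h"
    using t by (auto simp: carrier_tensor)
  have "f (tensor_proj M N h) = g (tensor_proj M N h)"
    using eq
    by (intro free_module_linear_eq[OF L linear_map_comp[OF linear_map_tensor_proj fg(1)]
          linear_map_comp[OF linear_map_tensor_proj fg(2)] _ h(1)])
      (auto simp: tens_eq_proj)
  then show ?thesis
    using h by simp
qed

text \<open>The linear extension of \<open>\<beta>\<close> to the free module kills the bilinear
  relations and so factors through the quotient.\<close>

lemma tensor_universal:
  assumes L: "module K L" and \<beta>: "bilinear_map K M N L \<beta>"
  obtains h where "h \<in> extensional (carrier (M \<Otimes> N))" "linear_map K (M \<Otimes> N) L h"
    "\<And>x y. x \<in> carrier M \<Longrightarrow> y \<in> carrier N \<Longrightarrow> h (tens K M N x y) = \<beta> x y"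
proof -
  interpret L: module K L by (rule L)
  let ?b = "\<lambda>(x, y). \<beta> x y"
  let ?S = "carrier M \<times> carrier N"
  have b: "\<And>s. s \<in> ?S \<Longrightarrow> ?b s \<in> carrier L"
    using bilinear_mapD(1)[OF \<beta>] by auto
  define g where "g = free_lift K L ?b"
  have g: "linear_map K FMN L g"
    unfolding g_def using b by (rule linear_map_free_lift[OF L])
  have gs: "g (single K (x, y)) = \<beta> x y" if "x \<in> carrier M" "y \<in> carrier N" for x y
    unfolding g_def using free_lift_single[OF L b, where s = "(x, y)"] that by simp
  have sc: "single K (x, y) \<in> carrier FMN" if "x \<in> carrier M" "y \<in> carrier N" for x y
    using that by (intro single_closed M.is_cring) auto
  note lin = linear_mapD[OF g] linear_map_minus[OF F.module_axioms L g]
  \<comment> \<open>Bilinearity of \<open>\<beta>\<close> is needed only on generators; the kernel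
    is a submodule and therefore absorbs their span.\<close>
  have "bilinear_relations K M N \<subseteq> {f \<in> carrier FMN. g f = \<zero>\<^bsub>L\<^esub>}"
  proof (rule subsetI, rule CollectI, rule conjI)
    fix r assume r: "r \<in> bilinear_relations K M N"
    then show "r \<in> carrier FMN"
      using bilinear_relations_closed by blast
    show "g r = \<zero>\<^bsub>L\<^esub>"
      using r unfolding bilinear_relations_def Let_def
      by (auto simp: lin sc gs bilinear_mapD[OF \<beta>] L.r_neg L.minus_eq)
  qed
  then have ker: "BMN \<subseteq> {f \<in> carrier FMN. g f = \<zero>\<^bsub>L\<^esub>}"
    by (rule span_of_least[OF submodule_kernel[OF F.module_axioms L g]])
  \<comment> \<open>A coset is evaluated at a chosen representative; two representatives differ by
    an element of the kernel of \<open>g\<close>. The restriction to the carrier supplies the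
    extensionality that \<open>lift\<close> demands.\<close>
  define h where "h = restrict (\<lambda>X. g (SOME f. f \<in> carrier FMN \<and> X = tensor_proj M N f)) (carrier (M \<Otimes> N))"
  have h: "h (tensor_proj M N f) = g f" if f: "f \<in> carrier FMN" for f
  proof -
    define f' where "f' = (SOME f'. f' \<in> carrier FMN \<and> tensor_proj M N f = tensor_proj M N f')"
    have f': "f' \<in> carrier FMN \<and> tensor_proj M N f = tensor_proj M N f'"
      unfolding f'_def by (rule someI[of _ f]) (simp add: f)
    then have "f \<ominus>\<^bsub>FMN\<^esub> f' \<in> BMN"
      using tensor_proj_eq_iff f by blast
    then have "g f \<ominus>\<^bsub>L\<^esub> g f' = \<zero>\<^bsub>L\<^esub>"
      using ker lin f f' by auto
    then have "(g f \<ominus>\<^bsub>L\<^esub> g f') \<oplus>\<^bsub>L\<^esub> g f' = g f'"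
      using lin f' by simp
    then have "g f = g f'"
      using lin f f' by (simp add: L.minus_eq L.a_assoc L.l_neg)
    moreover have "h (tensor_proj M N f) = g f'"
      using f by (simp add: h_def f'_def carrier_tensor)
    ultimately show ?thesis by simp
  qed
  show ?thesis
  proof
    show "h \<in> extensional (carrier (M \<Otimes> N))"
      by (simp add: h_def)
    show "linear_map K (M \<Otimes> N) L h"
      by (rule linear_mapI) (auto simp: carrier_tensor add_tensor smult_tensor h lin)
    show "h (tens K M N x y) = \<beta> x y" if "x \<in> carrier M" "y \<in> carrier N" for x y
      using that by (simp add: tens_eq_proj h sc gs)
  qed
qed

text \<open>The definite description in \<open>lift\<close> is justified here: linearity determines
  the map on the carrier, extensionality determines it elsewhere.\<close>

lemma
  assumes L: "module K L" and \<beta>: "bilinear_map K M N L \<beta>"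
  shows linear_map_lift: "linear_map K (M \<Otimes> N) L (lift K M N L \<beta>)"
    and lift_tens: "x \<in> carrier M \<Longrightarrow> y \<in> carrier N \<Longrightarrow> lift K M N L \<beta> (tens K M N x y) = \<beta> x y"
proof -
  let ?P = "\<lambda>h. h \<in> extensional (carrier (M \<Otimes> N)) \<and> linear_map K (M \<Otimes> N) L h \<and>
    (\<forall>x\<in>carrier M. \<forall>y\<in>carrier N. h (tens K M N x y) = \<beta> x y)"
  obtain h where "h \<in> extensional (carrier (M \<Otimes> N))" "linear_map K (M \<Otimes> N) L h"
    "\<And>x y. x \<in> carrier M \<Longrightarrow> y \<in> carrier N \<Longrightarrow> h (tens K M N x y) = \<beta> x y"
    by (fact tensor_universal[OF L \<beta>])
  then have h: "?P h"
    by blast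
  have "h' = h" if h': "?P h'" for h'
  proof (rule extensionalityI)
    show "h' t = h t" if "t \<in> carrier (M \<Otimes> N)" for t
    proof (rule tensor_linear_eq[OF L _ _ _ that])
      show "h' (tens K M N x y) = h (tens K M N x y)" if "x \<in> carrier M" "y \<in> carrier N" for x y
        using h h' that by metis
    qed (use h h' in blast)+
  qed (use h h' in blast)+
  with h have "\<exists>!h. ?P h"
    by (rule ex1I)
  then have "?P (lift K M N L \<beta>)"
    unfolding lift_def by (rule theI'[where P = ?P])
  then show "linear_map K (M \<Otimes> N) L (lift K M N L \<beta>)"
    "x \<in> carrier M \<Longrightarrow> y \<in> carrier N \<Longrightarrow> lift K M N L \<beta> (tens K M N x y) = \<beta> x y"
    by simp_all
qed

lemma tensor_induct [consumes 1, case_names tens add smult]: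
  assumes "t \<in> carrier (M \<Otimes> N)"
    and tens: "\<And>x y. x \<in> carrier M \<Longrightarrow> y \<in> carrier N \<Longrightarrow> P (tens K M N x y)"
    and add: "\<And>s t. s \<in> carrier (M \<Otimes> N) \<Longrightarrow> t \<in> carrier (M \<Otimes> N) \<Longrightarrow> P s \<Longrightarrow> P t \<Longrightarrow>
      P (s \<oplus>\<^bsub>M \<Otimes> N\<^esub> t)"
    and smult: "\<And>c t. c \<in> carrier K \<Longrightarrow> t \<in> carrier (M \<Otimes> N) \<Longrightarrow> P t \<Longrightarrow> P (c \<odot>\<^bsub>M \<Otimes> N\<^esub> t)"
  shows "P t"
proof -
  have pure: "P (c \<odot>\<^bsub>M \<Otimes> N\<^esub> tens K M N x y)"
    if "c \<in> carrier K" "x \<in> carrier M" "y \<in> carrier N" for c x y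
    using that by (intro smult tens bilinear_mapD(1)[OF bilinear_tens])
  obtain f where f: "f \<in> carrier FMN" "t = tensor_proj M N f"
    using assms(1) by (rule tensor_rep)
  have "P (tensor_proj M N f)"
    using f(1)
  proof (induction f rule: free_module_induct[OF M.is_cring, consumes 1, case_names zero step])
    case zero
    \<comment> \<open>The induction rule has no case for zero, so zero is presented as a scalar
      multiple of a pure tensor.\<close>
    have "\<zero> \<odot>\<^bsub>M \<Otimes> N\<^esub> tens K M N \<zero>\<^bsub>M\<^esub> \<zero>\<^bsub>N\<^esub> = tensor_proj M N \<zero>\<^bsub>FMN\<^esub>"
      using T.smult_l_null[OF bilinear_mapD(1)[OF bilinear_tens]] by (simp add: zero_tensor)
    then show ?case
      using pure[of \<zero> "\<zero>\<^bsub>M\<^esub>" "\<zero>\<^bsub>N\<^esub>"] by simp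
  next
    case (step g c s)
    obtain x y where s: "s = (x, y)" "x \<in> carrier M" "y \<in> carrier N"
      using step(3) by auto
    have "single K s \<in> carrier FMN"
      by (rule single_closed[OF M.is_cring step(3)])
    then have "tensor_proj M N (c \<odot>\<^bsub>FMN\<^esub> single K s \<oplus>\<^bsub>FMN\<^esub> g) =
        c \<odot>\<^bsub>M \<Otimes> N\<^esub> tens K M N x y \<oplus>\<^bsub>M \<Otimes> N\<^esub> tensor_proj M N g"
      using step(1,2) by (simp add: tens_eq_proj s(1) add_tensor smult_tensor)
    then show ?case
      using add[OF _ tensor_proj_closed pure] step s
        T.smult_closed[OF _ bilinear_mapD(1)[OF bilinear_tens]] by simp
  qed
  then show ?thesis
    using f(2) by simp
qed

lemma tens_closed: "x \<in> carrier M \<Longrightarrow> y \<in> carrier N \<Longrightarrow> tens K M N x y \<in> carrier (M \<Otimes> N)"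
  by (rule bilinear_mapD(1)[OF bilinear_tens])

end

end

section \<open>Arrows\<close>

lemma arrow_of_simps [simp]:
  "source (arrow_of M N f) = M"
  "target (arrow_of M N f) = N"
  "x \<in> carrier M \<Longrightarrow> app (arrow_of M N f) x = f x"
  by (simp_all add: arrow_of_def)

lemma comp_arrow_simps [simp]:
  "source (g \<circ>\<^sub>a f) = source f"
  "target (g \<circ>\<^sub>a f) = target g"
  "x \<in> carrier (source f) \<Longrightarrow> app (g \<circ>\<^sub>a f) x = app g (app f x)"
  by (simp_all add: comp_arrow_def)

lemma ident_simps [simp]:
  "source (ident M) = M"
  "target (ident M) = M"
  "x \<in> carrier M \<Longrightarrow> app (ident M) x = x"
  by (simp_all add: ident_def)

context
  fixes K :: "('k, 'r) ring_scheme" (structure)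
begin

lemma tensor_product_factors [simp]:
  "lfactor (M \<Otimes> N) = M"
  "rfactor (M \<Otimes> N) = N"
  by (simp_all add: tensor_product_def Let_def)

lemma tensor_arrow_simps [simp]:
  "source (tensor_arrow K f g) = source f \<Otimes> source g"
  "target (tensor_arrow K f g) = target f \<Otimes> target g"
  by (simp_all add: tensor_arrow_def)

lemma assoc_simps [simp]:
  "source (assoc_right K M N L) = (M \<Otimes> N) \<Otimes> L"
  "target (assoc_right K M N L) = M \<Otimes> N \<Otimes> L"
  "source (assoc_left K M N L) = M \<Otimes> N \<Otimes> L"
  "target (assoc_left K M N L) = (M \<Otimes> N) \<Otimes> L"
  by (simp_all add: assoc_right_def assoc_left_def)

lemma mult_arrow_simps [simp]:
  "source (mult_arrow K A) = A \<Otimes> A"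
  "target (mult_arrow K A) = A"
  by (simp_all add: mult_arrow_def)

section \<open>Linear arrows, their composition and their tensor products\<close>

text \<open>The equation \<open>f = arrow_of (source f) (target f) (app f)\<close> says that
  \<open>app f\<close> is normalised outside the source, which makes arrows that agree on the
  carrier equal.\<close>

definition lin_arrow where
  "lin_arrow f \<longleftrightarrow> module K (source f) \<and> module K (target f) \<and>
    f = arrow_of (source f) (target f) (app f) \<and> linear_map K (source f) (target f) (app f)"

lemma lin_arrowD:
  assumes "lin_arrow f"
  shows "module K (source f)" "module K (target f)" "linear_map K (source f) (target f) (app f)"
    and "x \<in> carrier (source f) \<Longrightarrow> app f x \<in> carrier (target f)"
  using assms by (auto simp: lin_arrow_def dest: linear_mapD(1))

lemma lin_arrow_eqI:
  assumes "lin_arrow f" "lin_arrow g" "source f = source g" "target f = target g"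
    and "\<And>x. x \<in> carrier (source f) \<Longrightarrow> app f x = app g x"
  shows "f = g"
proof -
  have "f = arrow_of (source f) (target f) (app f)"
    using assms(1) by (simp add: lin_arrow_def)
  also have "\<dots> = arrow_of (source g) (target g) (app g)"
    using assms(3-5) by (auto simp: arrow_of_def restrict_def)
  also have "\<dots> = g"
    using assms(2) by (simp add: lin_arrow_def)
  finally show ?thesis .
qed

lemma linear_map_cong:
  assumes "module K M" "linear_map K M N f" "\<And>x. x \<in> carrier M \<Longrightarrow> f x = g x"
  shows "linear_map K M N g"
proof -
  interpret module K M by fact
  show ?thesis
    using assms(2,3) by (auto simp: linear_map_def Pi_iff)
qed

lemma lin_arrow_arrow_of:
  assumes "module K M" "module K N" "linear_map K M N f"
  shows "lin_arrow (arrow_of M N f)"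
  using assms linear_map_cong[OF assms(1,3), of "restrict f (carrier M)"]
  by (simp add: lin_arrow_def) (simp add: arrow_of_def)

lemma linear_map_ident: "linear_map K M M (\<lambda>x. x)"
  by (simp add: linear_map_def)

lemma lin_arrow_ident: "module K M \<Longrightarrow> lin_arrow (ident M)"
  unfolding ident_def by (intro lin_arrow_arrow_of linear_map_ident)

lemma lin_arrow_comp:
  "lin_arrow g \<Longrightarrow> lin_arrow f \<Longrightarrow> target f = source g \<Longrightarrow> lin_arrow (g \<circ>\<^sub>a f)"
  unfolding comp_arrow_def
  by (intro lin_arrow_arrow_of linear_map_comp[OF lin_arrowD(3)]) (auto dest: lin_arrowD)

lemma linear_map_tens_left:
  assumes "module K M" "module K N" "linear_map K L M f" "y \<in> carrier N"
  shows "linear_map K L (M \<Otimes> N) (\<lambda>t. tens K M N (f t) y)"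
  using bilinear_tens[OF assms(1,2)] assms(4) linear_map_comp[OF assms(3)]
  by (auto simp: bilinear_map_def)

lemma linear_map_tens_right:
  assumes "module K M" "module K N" "linear_map K L N f" "x \<in> carrier M"
  shows "linear_map K L (M \<Otimes> N) (\<lambda>t. tens K M N x (f t))"
  using bilinear_tens[OF assms(1,2)] assms(4) linear_map_comp[OF assms(3), of "M \<Otimes> N" "tens K M N x"]
  by (auto simp: bilinear_map_def)

lemma linear_map_app:
  assumes "lin_arrow f" "linear_map K L (source f) g" "target f = N"
  shows "linear_map K L N (\<lambda>t. app f (g t))"
  using linear_map_comp[OF assms(2) lin_arrowD(3)[OF assms(1)]] assms(3) by simp

lemma bilinear_map_comp:
  assumes "linear_map K M M' f" "linear_map K N N' g" "bilinear_map K M' N' L \<beta>"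
  shows "bilinear_map K M N L (\<lambda>x y. \<beta> (f x) (g y))"
proof (rule bilinear_mapI)
  fix x assume "x \<in> carrier M"
  then have "linear_map K N' L (\<beta> (f x))"
    using assms linear_mapD(1)[OF assms(1)] by (auto simp: bilinear_map_def)
  then show "linear_map K N L (\<lambda>y. \<beta> (f x) (g y))"
    by (rule linear_map_comp[OF assms(2)])
next
  fix y assume "y \<in> carrier N"
  then have "linear_map K M' L (\<lambda>x. \<beta> x (g y))"
    using assms linear_mapD(1)[OF assms(2)] by (auto simp: bilinear_map_def)
  then show "linear_map K M L (\<lambda>x. \<beta> (f x) (g y))"
    by (rule linear_map_comp[OF assms(1)])
qed

text \<open>The spaces in \<open>tens K M N\<close> are variables tied to the sources by premises,
  so the rule still rewrites after \<open>source f\<close> has been simplified to a concrete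
  space.\<close>

lemma
  assumes f: "lin_arrow f" and g: "lin_arrow g"
  shows lin_arrow_tensor: "lin_arrow (tensor_arrow K f g)"
    and app_tensor_arrow: "x \<in> carrier (source f) \<Longrightarrow> y \<in> carrier (source g) \<Longrightarrow>
      M = source f \<Longrightarrow> N = source g \<Longrightarrow>
      app (tensor_arrow K f g) (tens K M N x y) = tens K (target f) (target g) (app f x) (app g y)"
proof -
  note mods = lin_arrowD(1,2)[OF f] lin_arrowD(1,2)[OF g]
  have \<beta>: "bilinear_map K (source f) (source g) (target f \<Otimes> target g)
      (\<lambda>x y. tens K (target f) (target g) (app f x) (app g y))"
    by (rule bilinear_map_comp[OF lin_arrowD(3)[OF f] lin_arrowD(3)[OF g] bilinear_tens[OF mods(2,4)]])
  note lift = linear_map_lift[OF mods(1,3) module_tensor[OF mods(2,4)] \<beta>]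
    lift_tens[OF mods(1,3) module_tensor[OF mods(2,4)] \<beta>]
  show "lin_arrow (tensor_arrow K f g)"
    unfolding tensor_arrow_def by (intro lin_arrow_arrow_of module_tensor mods lift)
  show "app (tensor_arrow K f g) (tens K M N x y) = tens K (target f) (target g) (app f x) (app g y)"
    if "x \<in> carrier (source f)" "y \<in> carrier (source g)" "M = source f" "N = source g"
    using that by (simp add: tensor_arrow_def tens_closed[OF mods(1,3)] lift)
qed

text \<open>Rebracketing is a lift inside a lift, and the outer one needs the inner one to depend
  linearly on its parameter \<open>z\<close>. As the inner lift is known only on pure tensors,
  linearity in \<open>z\<close> is proved by induction on \<open>t\<close>.\<close>

lemma linear_map_lift_param:
  assumes M: "module K M" and N: "module K N" and P: "module K P"
    and bil: "\<And>z. z \<in> carrier L \<Longrightarrow> bilinear_map K M N P (\<lambda>x y. \<gamma> x y z)"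
    and lin: "\<And>x y. x \<in> carrier M \<Longrightarrow> y \<in> carrier N \<Longrightarrow> linear_map K L P (\<gamma> x y)"
    and L: "module K L" and t: "t \<in> carrier (M \<Otimes> N)"
  shows "linear_map K L P (\<lambda>z. lift K M N P (\<lambda>x y. \<gamma> x y z) t)"
proof -
  interpret P: module K P by (rule P)
  interpret L: module K L by (rule L)
  note l = linear_map_lift[OF M N P bil] and lt = lift_tens[OF M N P bil]
  show ?thesis
  proof (rule linear_mapI)
    fix z assume z: "z \<in> carrier L"
    then show "lift K M N P (\<lambda>x y. \<gamma> x y z) t \<in> carrier P"
      using linear_mapD(1)[OF l] t by blast
    fix z' assume z': "z' \<in> carrier L"
    have zz: "z \<oplus>\<^bsub>L\<^esub> z' \<in> carrier L"
      using z z' by simp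
    note ls = linear_mapD[OF l[OF z]] linear_mapD[OF l[OF z']] linear_mapD[OF l[OF zz]]
    show "lift K M N P (\<lambda>x y. \<gamma> x y (z \<oplus>\<^bsub>L\<^esub> z')) t =
        lift K M N P (\<lambda>x y. \<gamma> x y z) t \<oplus>\<^bsub>P\<^esub> lift K M N P (\<lambda>x y. \<gamma> x y z') t"
      using t
    proof (induction t rule: tensor_induct[OF M N, consumes 1, case_names tens add smult])
      case (tens x y)
      then show ?case
        using z z' linear_mapD(2)[OF lin[OF tens]] by (simp add: lt[OF zz] lt[OF z] lt[OF z'])
    next
      case (add s t)
      then show ?case
        by (simp add: ls P.a_ac)
    next
      case (smult c t)
      then show ?case
        by (simp add: ls P.smult_r_distr)
    qed
  next
    fix c z assume c: "c \<in> carrier K" and z: "z \<in> carrier L"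
    have cz: "c \<odot>\<^bsub>L\<^esub> z \<in> carrier L"
      using c z by simp
    note ls = linear_mapD[OF l[OF z]] linear_mapD[OF l[OF cz]]
    show "lift K M N P (\<lambda>x y. \<gamma> x y (c \<odot>\<^bsub>L\<^esub> z)) t = c \<odot>\<^bsub>P\<^esub> lift K M N P (\<lambda>x y. \<gamma> x y z) t"
      using t
    proof (induction t rule: tensor_induct[OF M N, consumes 1, case_names tens add smult])
      case (tens x y)
      then show ?case
        using c z linear_mapD(3)[OF lin[OF tens]] by (simp add: lt[OF cz] lt[OF z])
    next
      case (add s t)
      then show ?case
        using c by (simp add: ls P.smult_r_distr)
    next
      case (smult d t)
      then show ?case
        \<comment> \<open>The scalars \<open>c\<close> and \<open>d\<close> change places, so
          commutativity of \<open>K\<close> enters.\<close>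
        using c by (simp add: ls P.smult_assoc1[symmetric] P.R.m_comm)
    qed
  qed
qed

text \<open>The outer bilinear map is linear in the pair because it is a lift, and linear in the
  third factor by \<open>linear_map_lift_param\<close>.\<close>

lemma
  assumes M: "module K M" and N: "module K N" and L: "module K L"
  shows lin_arrow_assoc_right: "lin_arrow (assoc_right K M N L)"
    and app_assoc_right: "x \<in> carrier M \<Longrightarrow> y \<in> carrier N \<Longrightarrow> z \<in> carrier L \<Longrightarrow>
      app (assoc_right K M N L) (tens K (M \<Otimes> N) L (tens K M N x y) z) =
        tens K M (N \<Otimes> L) x (tens K N L y z)"
proof -
  let ?P = "M \<Otimes> N \<Otimes> L"
  let ?\<gamma> = "\<lambda>x y z. tens K M (N \<Otimes> L) x (tens K N L y z)"
  note MN = module_tensor[OF M N] and NL = module_tensor[OF N L]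
  note P = module_tensor[OF M NL]
  have bil: "bilinear_map K M N ?P (\<lambda>x y. ?\<gamma> x y z)" if "z \<in> carrier L" for z
    using that
    by (intro bilinear_mapI linear_map_tens_left linear_map_tens_right linear_map_ident M N L NL)
      (auto intro: tens_closed[OF N L])
  have lin: "linear_map K L ?P (?\<gamma> x y)" if "x \<in> carrier M" "y \<in> carrier N" for x y
    using that by (intro linear_map_tens_right linear_map_ident M N L NL)
  have \<beta>: "bilinear_map K (M \<Otimes> N) L ?P (\<lambda>t z. lift K M N ?P (\<lambda>x y. ?\<gamma> x y z) t)"
    using linear_map_lift_param[OF M N P bil lin L] linear_map_lift[OF M N P bil]
    by (intro bilinear_mapI) simp_all
  show "lin_arrow (assoc_right K M N L)"
    unfolding assoc_right_def
    by (intro lin_arrow_arrow_of module_tensor M N L linear_map_lift[OF MN L P \<beta>])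
  show "app (assoc_right K M N L) (tens K (M \<Otimes> N) L (tens K M N x y) z) = ?\<gamma> x y z"
    if "x \<in> carrier M" "y \<in> carrier N" "z \<in> carrier L"
    using that unfolding assoc_right_def
    by (simp add: tens_closed[OF MN L] tens_closed[OF M N] lift_tens[OF MN L P \<beta>] lift_tens[OF M N P bil])
qed

lemma
  assumes M: "module K M" and N: "module K N" and L: "module K L"
  shows lin_arrow_assoc_left: "lin_arrow (assoc_left K M N L)"
    and app_assoc_left: "x \<in> carrier M \<Longrightarrow> y \<in> carrier N \<Longrightarrow> z \<in> carrier L \<Longrightarrow>
      app (assoc_left K M N L) (tens K M (N \<Otimes> L) x (tens K N L y z)) =
        tens K (M \<Otimes> N) L (tens K M N x y) z"
proof -
  let ?P = "(M \<Otimes> N) \<Otimes> L"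
  \<comment> \<open>The arguments are permuted because now the first factor is the parameter of the
    inner lift.\<close>
  let ?\<gamma> = "\<lambda>y z x. tens K (M \<Otimes> N) L (tens K M N x y) z"
  note MN = module_tensor[OF M N] and NL = module_tensor[OF N L]
  note P = module_tensor[OF MN L]
  have bil: "bilinear_map K N L ?P (\<lambda>y z. ?\<gamma> y z x)" if "x \<in> carrier M" for x
    using that
    by (intro bilinear_mapI linear_map_tens_left linear_map_tens_right linear_map_ident M N L MN)
      (auto intro: tens_closed[OF M N])
  have lin: "linear_map K M ?P (?\<gamma> y z)" if "y \<in> carrier N" "z \<in> carrier L" for y z
    using that by (intro linear_map_tens_left linear_map_ident M N L MN)
  have \<beta>: "bilinear_map K M (N \<Otimes> L) ?P (\<lambda>x t. lift K N L ?P (\<lambda>y z. ?\<gamma> y z x) t)"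
    using linear_map_lift_param[OF N L P bil lin M] linear_map_lift[OF N L P bil]
    by (intro bilinear_mapI) simp_all
  show "lin_arrow (assoc_left K M N L)"
    unfolding assoc_left_def
    by (intro lin_arrow_arrow_of module_tensor M N L linear_map_lift[OF M NL P \<beta>])
  show "app (assoc_left K M N L) (tens K M (N \<Otimes> L) x (tens K N L y z)) = ?\<gamma> y z x"
    if "x \<in> carrier M" "y \<in> carrier N" "z \<in> carrier L"
    using that unfolding assoc_left_def
    by (simp add: tens_closed[OF M NL] tens_closed[OF N L] lift_tens[OF M NL P \<beta>] lift_tens[OF N L P bil])
qed

lemma bilinear_mult: "assoc_algebra K A \<Longrightarrow> bilinear_map K A A A (mult A)"
  by (auto simp: assoc_algebra_def bilinear_map_def linear_map_def ring.ring_simprules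
      intro: monoid.m_closed dest: ring.is_monoid)

text \<open>Stated for a bilinear product, so that it also covers the mirror crossed product
  algebra, whose product is shown bilinear directly.\<close>

lemma
  assumes A: "module K A" and bil: "bilinear_map K A A A (mult A)"
  shows lin_arrow_mult: "lin_arrow (mult_arrow K A)"
    and app_mult_arrow: "x \<in> carrier A \<Longrightarrow> y \<in> carrier A \<Longrightarrow>
      app (mult_arrow K A) (tens K A A x y) = x \<otimes>\<^bsub>A\<^esub> y"
proof -
  note l = linear_map_lift[OF A A A bil] lift_tens[OF A A A bil]
  show "lin_arrow (mult_arrow K A)"
    unfolding mult_arrow_def by (intro lin_arrow_arrow_of module_tensor A l)
  show "app (mult_arrow K A) (tens K A A x y) = x \<otimes>\<^bsub>A\<^esub> y" if "x \<in> carrier A" "y \<in> carrier A"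
    using that by (simp add: mult_arrow_def tens_closed[OF A A] l)
qed

end

section \<open>Multiplication of crossed products on generators\<close>

context
  fixes K :: "('k, 'r) ring_scheme" (structure)
begin

lemma module_of_assoc_algebra: "assoc_algebra K A \<Longrightarrow> module K A"
  by (simp add: assoc_algebra_def)

lemma ring_of_assoc_algebra: "assoc_algebra K A \<Longrightarrow> ring A"
  by (simp add: assoc_algebra_def)

lemma app_closed:
  "lin_arrow K f \<Longrightarrow> target f = N \<Longrightarrow> x \<in> carrier (source f) \<Longrightarrow> app f x \<in> carrier N"
  using lin_arrowD(4)[of K f x] by simp

text \<open>Rules that evaluate a composite of arrows on pure tensors and discharge the typing
  conditions on the way.\<close>

lemmas tensor_simps =
  module_tensor tens_closed app_tensor_arrow lin_arrow_tensor lin_arrow_comp lin_arrow_ident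
  lin_arrow_assoc_right lin_arrow_assoc_left app_assoc_right app_assoc_left
  lin_arrow_mult app_mult_arrow lin_arrow_arrow_of app_closed module_of_assoc_algebra bilinear_mult
  tensor_arrow_21_def tensor_arrow_22_def tensor_arrow_23_def tensor_arrow_31_def mult2_arrow_def

text \<open>In \<open>(1 \<otimes> v)(a \<otimes> 1)\<close> the map \<open>R\<close> acts first and
  \<open>\<sigma>\<close> then meets the distinguished element; in
  \<open>(1 \<otimes> v)(1 \<otimes> v')\<close> the map \<open>R\<close> meets the unit and only
  \<open>\<sigma>\<close> acts. The unit laws leave exactly \<open>R\<close> and
  \<open>\<sigma>\<close>.\<close>

lemma
  assumes cp: "crossed_product K A V oneV R \<sigma>"
  shows crossed_algebra_mult_R: "v \<in> carrier V \<Longrightarrow> a \<in> carrier A \<Longrightarrow>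
      tens K A V \<one>\<^bsub>A\<^esub> v \<otimes>\<^bsub>crossed_algebra K A V oneV R \<sigma>\<^esub> tens K A V a oneV = R (tens K V A v a)"
    and crossed_algebra_mult_sigma: "v \<in> carrier V \<Longrightarrow> v' \<in> carrier V \<Longrightarrow>
      tens K A V \<one>\<^bsub>A\<^esub> v \<otimes>\<^bsub>crossed_algebra K A V oneV R \<sigma>\<^esub> tens K A V \<one>\<^bsub>A\<^esub> v' = \<sigma> (tens K V V v v')"
proof -
  have A: "assoc_algebra K A" and V: "module K V" and oneV: "oneV \<in> carrier V"
    and R: "linear_map K (V \<Otimes> A) (A \<Otimes> V) R" and \<sigma>: "linear_map K (V \<Otimes> V) (A \<Otimes> V) \<sigma>"
    and R1: "\<And>v. v \<in> carrier V \<Longrightarrow> R (tens K V A v \<one>\<^bsub>A\<^esub>) = tens K A V \<one>\<^bsub>A\<^esub> v"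
    and \<sigma>1: "\<And>v. v \<in> carrier V \<Longrightarrow> \<sigma> (tens K V V v oneV) = tens K A V \<one>\<^bsub>A\<^esub> v"
    using cp by (simp_all add: crossed_product_def)
  interpret A: ring A
    using A by (rule ring_of_assoc_algebra)
  have mA: "module K A"
    using A by (rule module_of_assoc_algebra)
  note simps = tensor_simps A V oneV R \<sigma> R1 \<sigma>1 linear_mapD(1)[OF R] linear_mapD(1)[OF \<sigma>]
    crossed_algebra_def Let_def mA
  let ?R = "arrow_of (V \<Otimes> A) (A \<Otimes> V) R" and ?\<sigma> = "arrow_of (V \<Otimes> V) (A \<Otimes> V) \<sigma>"
  \<comment> \<open>As \<open>R(v \<otimes> a)\<close> is not a pure tensor, the stages after
    \<open>R\<close> are evaluated at an arbitrary \<open>t\<close>. They are linear in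
    \<open>t\<close> and the identity on pure tensors.\<close>
  have eval_R: "app (tensor_arrow_31 K (mult2_arrow K A) (ident V))
      (app (tensor_arrow K (ident A) (tensor_arrow K (ident A) ?\<sigma>))
        (tens K A (A \<Otimes> V \<Otimes> V) \<one>\<^bsub>A\<^esub> (app (assoc_right K A V V) (tens K (A \<Otimes> V) V t oneV)))) = t"
    if "t \<in> carrier (A \<Otimes> V)" for t
  proof (rule tensor_linear_eq[OF mA V module_tensor[OF mA V] _ linear_map_ident _ that])
    show "linear_map K (A \<Otimes> V) (A \<Otimes> V) (\<lambda>t. app (tensor_arrow_31 K (mult2_arrow K A) (ident V))
      (app (tensor_arrow K (ident A) (tensor_arrow K (ident A) ?\<sigma>))
        (tens K A (A \<Otimes> V \<Otimes> V) \<one>\<^bsub>A\<^esub> (app (assoc_right K A V V) (tens K (A \<Otimes> V) V t oneV)))))"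
      by (intro linear_map_app linear_map_tens_left linear_map_tens_right)
        (simp_all add: simps linear_map_ident linear_map_app linear_map_tens_left linear_map_tens_right)
  qed (simp add: simps)
  \<comment> \<open>Likewise for what remains to be done after \<open>\<sigma>\<close>: multiplying
    by two units.\<close>
  have eval_\<sigma>: "app (tensor_arrow_31 K (mult2_arrow K A) (ident V))
      (tens K A (A \<Otimes> A \<Otimes> V) \<one>\<^bsub>A\<^esub> (tens K A (A \<Otimes> V) \<one>\<^bsub>A\<^esub> t)) = t"
    if "t \<in> carrier (A \<Otimes> V)" for t
  proof (rule tensor_linear_eq[OF mA V module_tensor[OF mA V] _ linear_map_ident _ that])
    show "linear_map K (A \<Otimes> V) (A \<Otimes> V) (\<lambda>t. app (tensor_arrow_31 K (mult2_arrow K A) (ident V))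
      (tens K A (A \<Otimes> A \<Otimes> V) \<one>\<^bsub>A\<^esub> (tens K A (A \<Otimes> V) \<one>\<^bsub>A\<^esub> t)))"
      by (intro linear_map_app linear_map_tens_left linear_map_tens_right)
        (simp_all add: simps linear_map_ident linear_map_app linear_map_tens_left linear_map_tens_right)
  qed (simp add: simps)
  show "tens K A V \<one>\<^bsub>A\<^esub> v \<otimes>\<^bsub>crossed_algebra K A V oneV R \<sigma>\<^esub> tens K A V a oneV = R (tens K V A v a)"
    if "v \<in> carrier V" "a \<in> carrier A"
    using that eval_R[of "R (tens K V A v a)"] by (simp add: simps)
  show "tens K A V \<one>\<^bsub>A\<^esub> v \<otimes>\<^bsub>crossed_algebra K A V oneV R \<sigma>\<^esub> tens K A V \<one>\<^bsub>A\<^esub> v' = \<sigma> (tens K V V v v')"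
    if "v \<in> carrier V" "v' \<in> carrier V"
    using that eval_\<sigma>[of "\<sigma> (tens K V V v v')"] by (simp add: simps)
qed

text \<open>The mirror version of the computation for crossed products. The third identity makes
  \<open>b \<mapsto> 1 \<otimes> b\<close> multiplicative: there both \<open>P\<close> and
  \<open>\<nu>\<close> meet only \<open>oneW\<close>.\<close>

lemma
  assumes cp: "mirror_crossed_product K W oneW B P \<nu>"
  shows mirror_crossed_algebra_mult_P: "b \<in> carrier B \<Longrightarrow> w \<in> carrier W \<Longrightarrow>
      tens K W B oneW b \<otimes>\<^bsub>mirror_crossed_algebra K W oneW B P \<nu>\<^esub> tens K W B w \<one>\<^bsub>B\<^esub> = P (tens K B W b w)"
    and mirror_crossed_algebra_mult_nu: "w \<in> carrier W \<Longrightarrow> w' \<in> carrier W \<Longrightarrow>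
      tens K W B w \<one>\<^bsub>B\<^esub> \<otimes>\<^bsub>mirror_crossed_algebra K W oneW B P \<nu>\<^esub> tens K W B w' \<one>\<^bsub>B\<^esub> = \<nu> (tens K W W w w')"
    and mirror_crossed_algebra_mult_base: "b \<in> carrier B \<Longrightarrow> b' \<in> carrier B \<Longrightarrow>
      tens K W B oneW b \<otimes>\<^bsub>mirror_crossed_algebra K W oneW B P \<nu>\<^esub> tens K W B oneW b' =
        tens K W B oneW (b \<otimes>\<^bsub>B\<^esub> b')"
proof -
  have B: "assoc_algebra K B" and W: "module K W" and oneW: "oneW \<in> carrier W"
    and P: "linear_map K (B \<Otimes> W) (W \<Otimes> B) P" and \<nu>: "linear_map K (W \<Otimes> W) (W \<Otimes> B) \<nu>"
    and P1: "\<And>b. b \<in> carrier B \<Longrightarrow> P (tens K B W b oneW) = tens K W B oneW b"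
    and P2: "\<And>w. w \<in> carrier W \<Longrightarrow> P (tens K B W \<one>\<^bsub>B\<^esub> w) = tens K W B w \<one>\<^bsub>B\<^esub>"
    and \<nu>1: "\<And>w. w \<in> carrier W \<Longrightarrow> \<nu> (tens K W W oneW w) = tens K W B w \<one>\<^bsub>B\<^esub>"
    using cp by (simp_all add: mirror_crossed_product_def)
  interpret B: ring B
    using B by (rule ring_of_assoc_algebra)
  have mB: "module K B"
    using B by (rule module_of_assoc_algebra)
  note simps = tensor_simps B W oneW P \<nu> P1 P2 \<nu>1 linear_mapD(1)[OF P] linear_mapD(1)[OF \<nu>]
    mirror_crossed_algebra_def Let_def mB
  note lins = linear_map_ident linear_map_app linear_map_tens_left linear_map_tens_right
  let ?P = "arrow_of (B \<Otimes> W) (W \<Otimes> B) P" and ?\<nu> = "arrow_of (W \<Otimes> W) (W \<Otimes> B) \<nu>"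
  \<comment> \<open>Here \<open>t\<close> stands for \<open>P(b \<otimes> w)\<close>, after which
    \<open>\<nu>\<close> is applied with \<open>oneW\<close> on the left.\<close>
  have eval_P: "app (tensor_arrow K (ident W) (mult2_arrow K B))
      (app (tensor_arrow_22 K ?\<nu> (tensor_arrow K (ident B) (ident B)))
        (tens K W (W \<Otimes> B \<Otimes> B) oneW (app (assoc_right K W B B) (tens K (W \<Otimes> B) B t \<one>\<^bsub>B\<^esub>)))) = t"
    if "t \<in> carrier (W \<Otimes> B)" for t
  proof (rule tensor_linear_eq[OF W mB module_tensor[OF W mB] _ linear_map_ident _ that])
    show "linear_map K (W \<Otimes> B) (W \<Otimes> B) (\<lambda>t. app (tensor_arrow K (ident W) (mult2_arrow K B))
      (app (tensor_arrow_22 K ?\<nu> (tensor_arrow K (ident B) (ident B)))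
        (tens K W (W \<Otimes> B \<Otimes> B) oneW (app (assoc_right K W B B) (tens K (W \<Otimes> B) B t \<one>\<^bsub>B\<^esub>)))))"
      by (intro linear_map_app linear_map_tens_left linear_map_tens_right)
        (simp_all add: simps lins)
  qed (simp add: simps)
  \<comment> \<open>Here \<open>t\<close> stands for \<open>\<nu>(w \<otimes> w')\<close>, followed
    by two units of \<open>B\<close>.\<close>
  have eval_\<nu>: "app (tensor_arrow K (ident W) (mult2_arrow K B))
      (app (assoc_right K W B (B \<Otimes> B)) (tens K (W \<Otimes> B) (B \<Otimes> B) t (tens K B B \<one>\<^bsub>B\<^esub> \<one>\<^bsub>B\<^esub>))) = t"
    if "t \<in> carrier (W \<Otimes> B)" for t
  proof (rule tensor_linear_eq[OF W mB module_tensor[OF W mB] _ linear_map_ident _ that])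
    show "linear_map K (W \<Otimes> B) (W \<Otimes> B) (\<lambda>t. app (tensor_arrow K (ident W) (mult2_arrow K B))
      (app (assoc_right K W B (B \<Otimes> B)) (tens K (W \<Otimes> B) (B \<Otimes> B) t (tens K B B \<one>\<^bsub>B\<^esub> \<one>\<^bsub>B\<^esub>))))"
      by (intro linear_map_app linear_map_tens_left linear_map_tens_right)
        (simp_all add: simps lins)
  qed (simp add: simps)
  show "tens K W B oneW b \<otimes>\<^bsub>mirror_crossed_algebra K W oneW B P \<nu>\<^esub> tens K W B w \<one>\<^bsub>B\<^esub> = P (tens K B W b w)"
    if "b \<in> carrier B" "w \<in> carrier W"
    using that eval_P[of "P (tens K B W b w)"] by (simp add: simps)
  show "tens K W B w \<one>\<^bsub>B\<^esub> \<otimes>\<^bsub>mirror_crossed_algebra K W oneW B P \<nu>\<^esub> tens K W B w' \<one>\<^bsub>B\<^esub> = \<nu> (tens K W W w w')"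
    if "w \<in> carrier W" "w' \<in> carrier W"
    using that eval_\<nu>[of "\<nu> (tens K W W w w')"] by (simp add: simps)
  show "tens K W B oneW b \<otimes>\<^bsub>mirror_crossed_algebra K W oneW B P \<nu>\<^esub> tens K W B oneW b' =
        tens K W B oneW (b \<otimes>\<^bsub>B\<^esub> b')"
    if "b \<in> carrier B" "b' \<in> carrier B"
    using that by (simp add: simps)
qed

text \<open>The product is a linear arrow applied to \<open>tens\<close>, which is linear in each
  argument. This makes \<open>mult_arrow\<close> available for the mirror algebra.\<close>

lemma bilinear_mirror_crossed_algebra:
  assumes cp: "mirror_crossed_product K W oneW B P \<nu>"
  shows "bilinear_map K (W \<Otimes> B) (W \<Otimes> B) (W \<Otimes> B) (mult (mirror_crossed_algebra K W oneW B P \<nu>))"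
proof -
  have B: "assoc_algebra K B" and W: "module K W"
    and P: "linear_map K (B \<Otimes> W) (W \<Otimes> B) P" and \<nu>: "linear_map K (W \<Otimes> W) (W \<Otimes> B) \<nu>"
    using cp by (simp_all add: mirror_crossed_product_def)
  have mB: "module K B"
    using B by (rule module_of_assoc_algebra)
  note lins = linear_map_ident linear_map_tens_left linear_map_tens_right
  show ?thesis
    unfolding mirror_crossed_algebra_def Let_def
    by (intro bilinear_mapI; simp; intro linear_map_app) (simp_all add: tensor_simps B W mB P \<nu> lins)
qed

end

section \<open>Changing the algebra structure of a space\<close>

text \<open>Addition and scalar multiplication agree as functions, not only on the carrier, so the
  two spaces have literally the same relations, cosets and pure tensors.\<close>

definition same_space :: "('k, 'a, 'm) module_scheme \<Rightarrow> ('k, 'a, 'n) module_scheme \<Rightarrow> bool"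
  where "same_space M N \<longleftrightarrow>
    carrier M = carrier N \<and> \<zero>\<^bsub>M\<^esub> = \<zero>\<^bsub>N\<^esub> \<and> add M = add N \<and> smult M = smult N"

lemma same_space_refl: "same_space M M"
  by (simp add: same_space_def)

lemma same_space_update: "same_space (M\<lparr>mult := m, one := u\<rparr>) M"
  by (simp add: same_space_def)

context
  fixes K :: "('k, 'r) ring_scheme" (structure)
begin

lemma linear_map_same_space:
  assumes "same_space M M'" "same_space N N'"
  shows "linear_map K M N f \<longleftrightarrow> linear_map K M' N' f"
  using assms by (simp add: same_space_def linear_map_def)

lemma module_same_space:
  assumes "same_space M M'" "module K M'"
  shows "module K M"
proof -
  interpret M': module K M' by fact
  have "\<exists>y\<in>carrier M. y \<oplus>\<^bsub>M\<^esub> x = \<zero>\<^bsub>M\<^esub>" if "x \<in> carrier M" for x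
    using assms(1) that M'.l_neg M'.a_inv_closed by (auto simp: same_space_def)
  then show ?thesis
    using assms(1)
    by (intro moduleI M'.is_cring abelian_groupI)
      (simp_all add: same_space_def M'.a_ac M'.smult_l_distr M'.smult_r_distr M'.smult_assoc1)
qed

lemma
  assumes "same_space M M'" "same_space N N'"
  shows tens_same_space: "tens K M N = tens K M' N'"
    and tensor_same_space: "same_space (M \<Otimes> N) (M' \<Otimes> N')"
proof -
  have "bilinear_relations K M N = bilinear_relations K M' N'"
    using assms by (simp add: same_space_def bilinear_relations_def)
  then show "tens K M N = tens K M' N'" "same_space (M \<Otimes> N) (M' \<Otimes> N')"
    using assms by (simp_all add: same_space_def tens_def tensor_product_def Let_def fun_eq_iff)
qed

text \<open>The description that defines \<open>lift\<close> sees its source only through the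
  carrier, the linear structure and the pure tensors.\<close>

lemma lift_same_space:
  assumes "same_space M M'" "same_space N N'"
  shows "lift K M N L \<beta> = lift K M' N' L \<beta>"
proof -
  have "carrier (M \<Otimes> N) = carrier (M' \<Otimes> N')" "carrier M = carrier M'" "carrier N = carrier N'"
    using assms tensor_same_space[OF assms] by (auto simp: same_space_def)
  then show ?thesis
    by (simp add: lift_def tens_same_space[OF assms]
        linear_map_same_space[OF tensor_same_space[OF assms] same_space_refl])
qed

end

section \<open>Linear maps over an algebra\<close>

text \<open>
  The slice category over \<open>E\<close>: its objects are pairs of a vector space \<open>M\<close> and a linear map from
  \<open>M\<close> to \<open>E\<close>.  It is monoidal by the multiplication of \<open>E\<close>.
\<close>

definition over_tensor where
  "over_tensor K E X Y = (tensor_product K (fst X) (fst Y), lift K (fst X) (fst Y) E (\<lambda>x y. snd X x \<otimes>\<^bsub>E\<^esub> snd Y y))"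

locale algebra_over =
  fixes K :: "('k, 'r) ring_scheme" (structure) and E :: "('k, 'e, 's) module_scheme"
  assumes E: "assoc_algebra K E"
begin

lemma module_E: "module K E"
  using E by (rule module_of_assoc_algebra)

sublocale E: ring E
  using E by (rule ring_of_assoc_algebra)

abbreviation otensor (infixr "\<otimes>\<^sub>E" 80)
  where "X \<otimes>\<^sub>E Y \<equiv> over_tensor K E X Y"

definition over_obj where
  "over_obj X \<longleftrightarrow> module K (fst X) \<and> linear_map K (fst X) E (snd X)"

text \<open>A morphism of the slice category; its last condition is the commuting triangle over
  \<open>E\<close>, that is, preservation of values.\<close>

definition over_arrow where
  "over_arrow X f Y \<longleftrightarrow> over_obj X \<and> over_obj Y \<and> lin_arrow K f \<and> source f = fst X \<and> target f = fst Y \<and>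
    (\<forall>x\<in>carrier (fst X). snd Y (app f x) = snd X x)"

lemma over_objD:
  assumes "over_obj X"
  shows "module K (fst X)" "linear_map K (fst X) E (snd X)"
    "x \<in> carrier (fst X) \<Longrightarrow> snd X x \<in> carrier E"
  using assms linear_mapD(1) by (auto simp: over_obj_def)

lemma over_arrowD:
  assumes "over_arrow X f Y"
  shows "over_obj X" "over_obj Y" "lin_arrow K f" "source f = fst X" "target f = fst Y"
    "x \<in> carrier (fst X) \<Longrightarrow> snd Y (app f x) = snd X x"
    "x \<in> carrier (fst X) \<Longrightarrow> app f x \<in> carrier (fst Y)"
  using assms lin_arrowD(4)[of K f x] by (auto simp: over_arrow_def)

lemma fst_over_tensor [simp]: "fst (X \<otimes>\<^sub>E Y) = fst X \<Otimes> fst Y"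
  by (simp add: over_tensor_def)

lemma
  assumes X: "over_obj X" and Y: "over_obj Y"
  shows over_obj_tensor: "over_obj (X \<otimes>\<^sub>E Y)"
    and snd_over_tensor: "x \<in> carrier (fst X) \<Longrightarrow> y \<in> carrier (fst Y) \<Longrightarrow>
      M = fst X \<Longrightarrow> N = fst Y \<Longrightarrow> snd (X \<otimes>\<^sub>E Y) (tens K M N x y) = snd X x \<otimes>\<^bsub>E\<^esub> snd Y y"
proof -
  have bil: "bilinear_map K (fst X) (fst Y) E (\<lambda>x y. snd X x \<otimes>\<^bsub>E\<^esub> snd Y y)"
    by (rule bilinear_map_comp[OF over_objD(2)[OF X] over_objD(2)[OF Y] bilinear_mult[OF E]])
  note l = linear_map_lift[OF over_objD(1)[OF X] over_objD(1)[OF Y] module_E bil]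
    lift_tens[OF over_objD(1)[OF X] over_objD(1)[OF Y] module_E bil]
  show "over_obj (X \<otimes>\<^sub>E Y)"
    using l over_objD(1)[OF X] over_objD(1)[OF Y] by (simp add: over_obj_def over_tensor_def module_tensor)
  show "snd (X \<otimes>\<^sub>E Y) (tens K M N x y) = snd X x \<otimes>\<^bsub>E\<^esub> snd Y y"
    if "x \<in> carrier (fst X)" "y \<in> carrier (fst Y)" "M = fst X" "N = fst Y"
    using that l by (simp add: over_tensor_def)
qed

lemma over_arrowI:
  assumes "over_obj X" "over_obj Y" "lin_arrow K f" "source f = fst X" "target f = fst Y"
    and "\<And>x. x \<in> carrier (fst X) \<Longrightarrow> snd Y (app f x) = snd X x"
  shows "over_arrow X f Y"
  using assms by (simp add: over_arrow_def)

lemma over_arrow_of: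
  assumes "over_obj X" "over_obj Y" "linear_map K (fst X) (fst Y) h"
    and "\<And>x. x \<in> carrier (fst X) \<Longrightarrow> snd Y (h x) = snd X x"
  shows "over_arrow X (arrow_of (fst X) (fst Y) h) Y"
  using assms lin_arrow_arrow_of[OF over_objD(1)[OF assms(1)] over_objD(1)[OF assms(2)] assms(3)]
  by (intro over_arrowI) simp_all

text \<open>Both sides of the triangle are linear maps into \<open>E\<close>, so it suffices that it
  commutes on pure tensors.\<close>

lemma over_arrow_tensorI:
  assumes X: "over_obj X" and Y: "over_obj Y" and Z: "over_obj Z" and f: "lin_arrow K f"
    and src: "source f = fst X \<Otimes> fst Y" and tgt: "target f = fst Z"
    and eq: "\<And>x y. x \<in> carrier (fst X) \<Longrightarrow> y \<in> carrier (fst Y) \<Longrightarrow>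
      snd Z (app f (tens K (fst X) (fst Y) x y)) = snd X x \<otimes>\<^bsub>E\<^esub> snd Y y"
  shows "over_arrow (X \<otimes>\<^sub>E Y) f Z"
proof (rule over_arrowI)
  show "over_obj (X \<otimes>\<^sub>E Y)"
    using X Y by (rule over_obj_tensor)
  show "snd Z (app f t) = snd (X \<otimes>\<^sub>E Y) t" if "t \<in> carrier (fst (X \<otimes>\<^sub>E Y))" for t
  proof (rule tensor_linear_eq[OF over_objD(1)[OF X] over_objD(1)[OF Y] module_E])
    show "linear_map K (fst X \<Otimes> fst Y) E (\<lambda>t. snd Z (app f t))"
      using linear_map_comp[OF lin_arrowD(3)[OF f], of E "snd Z"] over_objD(2)[OF Z] src tgt by simp
    show "linear_map K (fst X \<Otimes> fst Y) E (snd (X \<otimes>\<^sub>E Y))"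
      using over_objD(2)[OF over_obj_tensor[OF X Y]] by simp
    show "t \<in> carrier (fst X \<Otimes> fst Y)"
      using that by simp
  qed (simp add: eq snd_over_tensor[OF X Y])
qed (use Z f src tgt in simp_all)

lemma over_arrow_ident: "over_obj (M, \<alpha>) \<Longrightarrow> over_arrow (M, \<alpha>) (ident M) (M, \<alpha>)"
  using over_objD(1)[of "(M, \<alpha>)"] by (intro over_arrowI) (simp_all add: lin_arrow_ident)

lemma over_arrow_comp:
  assumes f: "over_arrow X f Y" and g: "over_arrow Y g Z"
  shows "over_arrow X (g \<circ>\<^sub>a f) Z"
  using over_arrowD[OF f] over_arrowD[OF g]
  by (intro over_arrowI lin_arrow_comp) simp_all

lemma over_arrow_tensor:
  assumes f: "over_arrow X f Y" and g: "over_arrow X' g Y'"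
  shows "over_arrow (X \<otimes>\<^sub>E X') (tensor_arrow K f g) (Y \<otimes>\<^sub>E Y')"
  using over_arrowD[OF f] over_arrowD[OF g]
  by (intro over_arrow_tensorI over_obj_tensor lin_arrow_tensor)
    (simp_all add: app_tensor_arrow snd_over_tensor)

text \<open>On pure tensors this is associativity of the product of \<open>E\<close>.\<close>

lemma over_arrow_assoc_right:
  assumes X: "over_obj X" and Y: "over_obj Y" and Z: "over_obj Z"
  shows "over_arrow ((X \<otimes>\<^sub>E Y) \<otimes>\<^sub>E Z) (assoc_right K (fst X) (fst Y) (fst Z)) (X \<otimes>\<^sub>E Y \<otimes>\<^sub>E Z)"
proof (rule over_arrow_tensorI)
  fix t z assume t: "t \<in> carrier (fst (X \<otimes>\<^sub>E Y))" and z: "z \<in> carrier (fst Z)"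
  note mods = over_objD(1)[OF X] over_objD(1)[OF Y] over_objD(1)[OF Z]
  note ar = lin_arrow_assoc_right[OF mods]
  \<comment> \<open>Only the outer tensor is pure so far; \<open>t\<close> still ranges over the
    whole of the inner product, hence a second reduction.\<close>
  have "snd (X \<otimes>\<^sub>E Y \<otimes>\<^sub>E Z) (app (assoc_right K (fst X) (fst Y) (fst Z)) (tens K (fst X \<Otimes> fst Y) (fst Z) t z)) =
      snd (X \<otimes>\<^sub>E Y) t \<otimes>\<^bsub>E\<^esub> snd Z z"
  proof (rule tensor_linear_eq[OF mods(1,2) module_E])
    show "linear_map K (fst X \<Otimes> fst Y) E (\<lambda>t. snd (X \<otimes>\<^sub>E Y \<otimes>\<^sub>E Z)
        (app (assoc_right K (fst X) (fst Y) (fst Z)) (tens K (fst X \<Otimes> fst Y) (fst Z) t z)))"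
      using over_objD(2)[OF over_obj_tensor[OF X over_obj_tensor[OF Y Z]]] z
      by (intro linear_map_comp[OF linear_map_app[OF ar]])
        (auto intro!: linear_map_tens_left linear_map_ident module_tensor mods)
    show "linear_map K (fst X \<Otimes> fst Y) E (\<lambda>t. snd (X \<otimes>\<^sub>E Y) t \<otimes>\<^bsub>E\<^esub> snd Z z)"
      using bilinear_mult[OF E] over_objD(3)[OF Z z] over_objD(2)[OF over_obj_tensor[OF X Y]]
      by (auto simp: bilinear_map_def intro: linear_map_comp)
    show "t \<in> carrier (fst X \<Otimes> fst Y)"
      using t by simp
  qed (use z X Y Z mods in \<open>simp add: app_assoc_right snd_over_tensor over_obj_tensor tens_closed
      E.m_assoc over_objD(3)\<close>)
  then show "snd (X \<otimes>\<^sub>E Y \<otimes>\<^sub>E Z) (app (assoc_right K (fst X) (fst Y) (fst Z)) (tens K (fst (X \<otimes>\<^sub>E Y)) (fst Z) t z)) =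
      snd (X \<otimes>\<^sub>E Y) t \<otimes>\<^bsub>E\<^esub> snd Z z"
    by simp
qed (use assms in \<open>simp_all add: over_obj_tensor lin_arrow_assoc_right over_objD(1)\<close>)

lemma over_arrow_assoc_left:
  assumes X: "over_obj X" and Y: "over_obj Y" and Z: "over_obj Z"
  shows "over_arrow (X \<otimes>\<^sub>E Y \<otimes>\<^sub>E Z) (assoc_left K (fst X) (fst Y) (fst Z)) ((X \<otimes>\<^sub>E Y) \<otimes>\<^sub>E Z)"
proof (rule over_arrow_tensorI)
  fix x t assume x: "x \<in> carrier (fst X)" and t: "t \<in> carrier (fst (Y \<otimes>\<^sub>E Z))"
  note mods = over_objD(1)[OF X] over_objD(1)[OF Y] over_objD(1)[OF Z]
  note al = lin_arrow_assoc_left[OF mods]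
  have "snd ((X \<otimes>\<^sub>E Y) \<otimes>\<^sub>E Z) (app (assoc_left K (fst X) (fst Y) (fst Z)) (tens K (fst X) (fst Y \<Otimes> fst Z) x t)) =
      snd X x \<otimes>\<^bsub>E\<^esub> snd (Y \<otimes>\<^sub>E Z) t"
  proof (rule tensor_linear_eq[OF mods(2,3) module_E])
    show "linear_map K (fst Y \<Otimes> fst Z) E (\<lambda>t. snd ((X \<otimes>\<^sub>E Y) \<otimes>\<^sub>E Z)
        (app (assoc_left K (fst X) (fst Y) (fst Z)) (tens K (fst X) (fst Y \<Otimes> fst Z) x t)))"
      using over_objD(2)[OF over_obj_tensor[OF over_obj_tensor[OF X Y] Z]] x
      by (intro linear_map_comp[OF linear_map_app[OF al]])
        (auto intro!: linear_map_tens_right linear_map_ident module_tensor mods)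
    show "linear_map K (fst Y \<Otimes> fst Z) E (\<lambda>t. snd X x \<otimes>\<^bsub>E\<^esub> snd (Y \<otimes>\<^sub>E Z) t)"
      using bilinear_mult[OF E] over_objD(3)[OF X x] over_objD(2)[OF over_obj_tensor[OF Y Z]]
      by (auto simp: bilinear_map_def intro: linear_map_comp)
    show "t \<in> carrier (fst Y \<Otimes> fst Z)"
      using t by simp
  qed (use x X Y Z mods in \<open>simp add: app_assoc_left snd_over_tensor over_obj_tensor tens_closed
      E.m_assoc over_objD(3)\<close>)
  then show "snd ((X \<otimes>\<^sub>E Y) \<otimes>\<^sub>E Z) (app (assoc_left K (fst X) (fst Y) (fst Z)) (tens K (fst X) (fst (Y \<otimes>\<^sub>E Z)) x t)) =
      snd X x \<otimes>\<^bsub>E\<^esub> snd (Y \<otimes>\<^sub>E Z) t"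
    by simp
qed (use assms in \<open>simp_all add: over_obj_tensor lin_arrow_assoc_left over_objD(1)\<close>)

section \<open>The rebracketed tensor operations over \<open>E\<close>\<close>

lemma over_arrow_21:
  assumes f: "over_arrow (X \<otimes>\<^sub>E Y) f Z" and g: "over_arrow X' g Y'"
    and "over_obj X" "over_obj Y"
  shows "over_arrow (X \<otimes>\<^sub>E Y \<otimes>\<^sub>E X') (tensor_arrow_21 K f g) (Z \<otimes>\<^sub>E Y')"
  using over_arrow_comp[OF over_arrow_assoc_left over_arrow_tensor[OF f g], OF assms(3,4) over_arrowD(1)[OF g]]
  by (simp add: tensor_arrow_21_def over_arrowD(4)[OF f] over_arrowD(4)[OF g])

lemma over_arrow_22:
  assumes f: "over_arrow (X \<otimes>\<^sub>E Y) f (Z \<otimes>\<^sub>E T)" and g: "over_arrow X' g Y'"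
    and "over_obj X" "over_obj Y" "over_obj Z" "over_obj T"
  shows "over_arrow (X \<otimes>\<^sub>E Y \<otimes>\<^sub>E X') (tensor_arrow_22 K f g) (Z \<otimes>\<^sub>E T \<otimes>\<^sub>E Y')"
  using over_arrow_comp[OF over_arrow_21[OF f g] over_arrow_assoc_right, OF assms(3-6) over_arrowD(2)[OF g]]
  by (simp add: tensor_arrow_22_def over_arrowD(5)[OF f] over_arrowD(5)[OF g])

text \<open>The form for an abstract object. For a concrete space the pair form
  \<open>over_arrow_ident\<close> is the one that unifies.\<close>

lemma over_arrow_ident': "over_obj X \<Longrightarrow> over_arrow X (ident (fst X)) X"
  using over_arrow_ident[of "fst X" "snd X"] by simp

lemma over_arrow_23:
  assumes f: "over_arrow (X \<otimes>\<^sub>E Y) f (Z \<otimes>\<^sub>E T \<otimes>\<^sub>E U)" and g: "over_arrow X' g Y'"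
    and "over_obj X" "over_obj Y" "over_obj Z" "over_obj T" "over_obj U"
  shows "over_arrow (X \<otimes>\<^sub>E Y \<otimes>\<^sub>E X') (tensor_arrow_23 K f g) (Z \<otimes>\<^sub>E T \<otimes>\<^sub>E U \<otimes>\<^sub>E Y')"
  using over_arrow_comp[OF over_arrow_22[OF f g assms(3-5) over_obj_tensor[OF assms(6,7)]]
      over_arrow_tensor[OF over_arrow_ident'[OF assms(5)]
        over_arrow_assoc_right[OF assms(6,7) over_arrowD(2)[OF g]]]]
  by (simp add: tensor_arrow_23_def over_arrowD(5)[OF f] over_arrowD(5)[OF g])

lemma over_arrow_31:
  assumes f: "over_arrow (X \<otimes>\<^sub>E Y \<otimes>\<^sub>E Z) f T" and g: "over_arrow X' g Y'"
    and "over_obj X" "over_obj Y" "over_obj Z"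
  shows "over_arrow (X \<otimes>\<^sub>E Y \<otimes>\<^sub>E Z \<otimes>\<^sub>E X') (tensor_arrow_31 K f g) (T \<otimes>\<^sub>E Y')"
  using over_arrow_comp[OF over_arrow_tensor[OF over_arrow_ident'[OF assms(3)]
        over_arrow_assoc_left[OF assms(4,5) over_arrowD(1)[OF g]]]
      over_arrow_21[OF f g assms(3) over_obj_tensor[OF assms(4,5)]]]
  by (simp add: tensor_arrow_31_def over_arrowD(4)[OF f] over_arrowD(4)[OF g])

section \<open>Multiplication maps, uniqueness of arrows and crossed product algebras over
  \<open>E\<close>\<close>

lemma over_arrow_mult:
  assumes A: "over_obj (A, \<alpha>)" and bil: "bilinear_map K A A A (mult A)"
    and hom: "\<And>x y. x \<in> carrier A \<Longrightarrow> y \<in> carrier A \<Longrightarrow> \<alpha> (x \<otimes>\<^bsub>A\<^esub> y) = \<alpha> x \<otimes>\<^bsub>E\<^esub> \<alpha> y"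
  shows "over_arrow ((A, \<alpha>) \<otimes>\<^sub>E (A, \<alpha>)) (mult_arrow K A) (A, \<alpha>)"
  using over_objD(1)[OF A] A bil hom
  by (intro over_arrow_tensorI) (simp_all add: lin_arrow_mult app_mult_arrow)

lemma over_arrow_mult2:
  assumes "over_obj (A, \<alpha>)" and "over_arrow ((A, \<alpha>) \<otimes>\<^sub>E (A, \<alpha>)) (mult_arrow K A) (A, \<alpha>)"
  shows "over_arrow ((A, \<alpha>) \<otimes>\<^sub>E (A, \<alpha>) \<otimes>\<^sub>E (A, \<alpha>)) (mult2_arrow K A) (A, \<alpha>)"
  unfolding mult2_arrow_def
  by (rule over_arrow_comp[OF over_arrow_tensor[OF over_arrow_ident]]) (use assms in auto)

text \<open>An injective structure map makes \<open>Y\<close> a subobject of the terminal object of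
  the slice category, so parallel arrows into it coincide.\<close>

lemma over_arrow_unique:
  assumes f: "over_arrow X f Y" and g: "over_arrow X g Y" and inj: "inj_on (snd Y) (carrier (fst Y))"
  shows "f = g"
proof (rule lin_arrow_eqI)
  fix x assume "x \<in> carrier (source f)"
  then show "app f x = app g x"
    using inj over_arrowD[OF f] over_arrowD[OF g] by (metis inj_onD)
qed (use over_arrowD[OF f] over_arrowD[OF g] in simp_all)

lemma over_arrow_of_tensor:
  assumes "over_obj X" "over_obj Y" "over_obj Z" "linear_map K (fst X \<Otimes> fst Y) (fst Z) h"
    and "\<And>x y. x \<in> carrier (fst X) \<Longrightarrow> y \<in> carrier (fst Y) \<Longrightarrow>
      snd Z (h (tens K (fst X) (fst Y) x y)) = snd X x \<otimes>\<^bsub>E\<^esub> snd Y y"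
  shows "over_arrow (X \<otimes>\<^sub>E Y) (arrow_of (fst X \<Otimes> fst Y) (fst Z) h) Z"
  using assms over_objD(1)[OF assms(1)] over_objD(1)[OF assms(2)] over_objD(1)[OF assms(3)]
  by (intro over_arrow_tensorI) (simp_all add: lin_arrow_arrow_of module_tensor tens_closed)

text \<open>The product is a composite of value-preserving arrows applied to
  \<open>x \<otimes> y\<close>, whose value is the product of the values in
  \<open>E\<close>.\<close>

lemma over_crossed_algebra_mult:
  assumes A: "over_obj (A, \<alpha>)" and V: "over_obj (V, \<kappa>)"
    and \<mu>: "over_arrow ((A, \<alpha>) \<otimes>\<^sub>E (A, \<alpha>)) (mult_arrow K A) (A, \<alpha>)"
    and R: "over_arrow ((V, \<kappa>) \<otimes>\<^sub>E (A, \<alpha>)) (arrow_of (V \<Otimes> A) (A \<Otimes> V) R) ((A, \<alpha>) \<otimes>\<^sub>E (V, \<kappa>))"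
    and \<sigma>: "over_arrow ((V, \<kappa>) \<otimes>\<^sub>E (V, \<kappa>)) (arrow_of (V \<Otimes> V) (A \<Otimes> V) \<sigma>) ((A, \<alpha>) \<otimes>\<^sub>E (V, \<kappa>))"
    and x: "x \<in> carrier (A \<Otimes> V)" and y: "y \<in> carrier (A \<Otimes> V)"
  shows "x \<otimes>\<^bsub>crossed_algebra K A V oneV R \<sigma>\<^esub> y \<in> carrier (A \<Otimes> V)"
    and "snd ((A, \<alpha>) \<otimes>\<^sub>E (V, \<kappa>)) (x \<otimes>\<^bsub>crossed_algebra K A V oneV R \<sigma>\<^esub> y) =
      snd ((A, \<alpha>) \<otimes>\<^sub>E (V, \<kappa>)) x \<otimes>\<^bsub>E\<^esub> snd ((A, \<alpha>) \<otimes>\<^sub>E (V, \<kappa>)) y"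
proof -
  let ?A = "(A, \<alpha>)" and ?V = "(V, \<kappa>)"
  let ?m = "tensor_arrow_31 K (mult2_arrow K A) (ident V) \<circ>\<^sub>a
    tensor_arrow K (ident A) (tensor_arrow K (ident A) (arrow_of (V \<Otimes> V) (A \<Otimes> V) \<sigma>)) \<circ>\<^sub>a
    tensor_arrow K (ident A) (tensor_arrow_22 K (arrow_of (V \<Otimes> A) (A \<Otimes> V) R) (ident V)) \<circ>\<^sub>a
    assoc_right K A V (A \<Otimes> V)"
  \<comment> \<open>The general rule speaks of \<open>fst X\<close>, which does not unify with
    concrete spaces; this instance has the projections evaluated.\<close>
  have ar: "over_arrow ((?A \<otimes>\<^sub>E ?V) \<otimes>\<^sub>E ?A \<otimes>\<^sub>E ?V) (assoc_right K A V (A \<Otimes> V)) (?A \<otimes>\<^sub>E ?V \<otimes>\<^sub>E ?A \<otimes>\<^sub>E ?V)"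
    using over_arrow_assoc_right[OF A V over_obj_tensor[OF A V]] by simp
  have m: "over_arrow ((?A \<otimes>\<^sub>E ?V) \<otimes>\<^sub>E ?A \<otimes>\<^sub>E ?V) ?m (?A \<otimes>\<^sub>E ?V)"
    by (rule over_arrow_comp[OF ar] over_arrow_comp over_arrow_tensor over_arrow_ident over_arrow_31
        over_arrow_22 over_arrow_mult2 A V \<mu> R \<sigma>)+
  have AV: "module K (A \<Otimes> V)"
    using over_objD(1)[OF over_obj_tensor[OF A V]] by simp
  have eq: "x \<otimes>\<^bsub>crossed_algebra K A V oneV R \<sigma>\<^esub> y = app ?m (tens K (A \<Otimes> V) (A \<Otimes> V) x y)"
    by (simp only: crossed_algebra_def Let_def module.simps) simp
  have xy: "tens K (A \<Otimes> V) (A \<Otimes> V) x y \<in> carrier (fst ((?A \<otimes>\<^sub>E ?V) \<otimes>\<^sub>E ?A \<otimes>\<^sub>E ?V))"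
    using tens_closed[OF AV AV x y] by simp
  show "x \<otimes>\<^bsub>crossed_algebra K A V oneV R \<sigma>\<^esub> y \<in> carrier (A \<Otimes> V)"
    using over_arrowD(7)[OF m xy] by (simp only: eq fst_over_tensor fst_conv)
  show "snd (?A \<otimes>\<^sub>E ?V) (x \<otimes>\<^bsub>crossed_algebra K A V oneV R \<sigma>\<^esub> y) =
      snd (?A \<otimes>\<^sub>E ?V) x \<otimes>\<^bsub>E\<^esub> snd (?A \<otimes>\<^sub>E ?V) y"
    unfolding eq over_arrowD(6)[OF m xy]
    by (rule snd_over_tensor) (use A V x y in \<open>simp_all add: over_obj_tensor\<close>)
qed

end

theorem theorem2p5:
  fixes K :: "('k, 'r) ring_scheme" (structure)
    and W :: "('k, 'w, 'p) module_scheme" and oneW :: 'w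
    and D :: "('k, 'd, 'm) module_scheme"
    and V :: "('k, 'v, 'q) module_scheme" and oneV :: 'v
  assumes "field K"
    and "assoc_algebra K D"
    and "module K W" and "oneW \<in> carrier W"
    and "module K V" and "oneV \<in> carrier V"
    and "mirror_crossed_product K W oneW D P \<nu>"
    and "crossed_product K D V oneV R \<sigma>"
    and E: "E = (W \<Otimes> D \<Otimes> V)\<lparr>mult := m, one := u\<rparr>"
    and "assoc_algebra K E"
    and "algebra_map K (mirror_crossed_algebra K W oneW D P \<nu>) E
           (lift K W D (W \<Otimes> D \<Otimes> V) (\<lambda>w d. tens3 K W D V w d oneV))"
    and "algebra_map K (crossed_algebra K D V oneV R \<sigma>) E
           (lift K D V (W \<Otimes> D \<Otimes> V) (\<lambda>d v. tens3 K W D V oneW d v))"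
    and "\<And>w d v. w \<in> carrier W \<Longrightarrow> d \<in> carrier D \<Longrightarrow> v \<in> carrier V \<Longrightarrow>
           tens3 K W D V w d v =
             tens3 K W D V w \<one>\<^bsub>D\<^esub> oneV \<otimes>\<^bsub>E\<^esub> tens3 K W D V oneW d oneV
               \<otimes>\<^bsub>E\<^esub> tens3 K W D V oneW \<one>\<^bsub>D\<^esub> v"
  shows "\<exists>Q. iteration_map K W oneW D V oneV P \<nu> R \<sigma> Q \<and>
           same_algebra K E (iterated_crossed_algebra K W oneW D V oneV P \<nu> R \<sigma> Q) \<and>
           (\<forall>v\<in>carrier V. \<forall>w\<in>carrier W.
              Q (tens K V W v w) =
                tens3 K W D V oneW \<one>\<^bsub>D\<^esub> v \<otimes>\<^bsub>E\<^esub> tens3 K W D V w \<one>\<^bsub>D\<^esub> oneV)"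
proof -
  note D = assms(2) and W = assms(3) and oneW = assms(4) and V = assms(5) and oneV = assms(6)
    and mirror = assms(7) and crossed = assms(8) and decomp = assms(13)
  interpret algebra_over K E
    by unfold_locales (rule assms(10))
  interpret D: ring D
    using D by (rule ring_of_assoc_algebra)
  have mD: "module K D"
    using D by (rule module_of_assoc_algebra)
  define WDV where "WDV = W \<Otimes> D \<Otimes> V"
  note DV = module_tensor[OF mD V] and WD = module_tensor[OF W mD]
  have WDV: "module K WDV"
    unfolding WDV_def by (rule module_tensor[OF W DV])
  have EW: "same_space E WDV"
    unfolding assms(9) WDV_def by (rule same_space_update)
  have carrier_E: "carrier E = carrier WDV"
    using EW by (simp add: same_space_def)
  \<comment> \<open>Structure maps have target \<open>E\<close>, tensor constructions have target
    \<open>WDV\<close>; linearity is the same for both.\<close>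
  have linE: "linear_map K M E f \<longleftrightarrow> linear_map K M WDV f" for M :: "('k, 'x, 'y) module_scheme" and f
    by (rule linear_map_same_space[OF same_space_refl EW])

  define i where "i = (\<lambda>w. tens3 K W D V w \<one>\<^bsub>D\<^esub> oneV)"
  define j where "j = (\<lambda>d. tens3 K W D V oneW d oneV)"
  define k where "k = (\<lambda>v. tens3 K W D V oneW \<one>\<^bsub>D\<^esub> v)"
  have lin3: "linear_map K W WDV (\<lambda>w. tens3 K W D V w d v)"
    "linear_map K D WDV (\<lambda>d. tens3 K W D V w d v)"
    "linear_map K V WDV (tens3 K W D V w d)"
    if "w \<in> carrier W" "d \<in> carrier D" "v \<in> carrier V" for w d v
    using that unfolding tens3_def WDV_def
    by (auto intro!: linear_map_tens_left linear_map_tens_right linear_map_ident W mD V DV tens_closed)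
  have Ow: "over_obj (W, i)" and Od: "over_obj (D, j)" and Ov: "over_obj (V, k)"
    using lin3[OF oneW D.one_closed oneV] W mD V
    by (simp_all add: over_obj_def linE i_def j_def k_def)
  note obj = Ow Od Ov
  have ijk: "tens3 K W D V w d v = i w \<otimes>\<^bsub>E\<^esub> j d \<otimes>\<^bsub>E\<^esub> k v"
    if "w \<in> carrier W" "d \<in> carrier D" "v \<in> carrier V" for w d v
    using decomp[OF that] by (simp add: i_def j_def k_def)
  have clo: "w \<in> carrier W \<Longrightarrow> i w \<in> carrier E" "d \<in> carrier D \<Longrightarrow> j d \<in> carrier E"
    "v \<in> carrier V \<Longrightarrow> k v \<in> carrier E" for w d v
    using over_objD(3)[OF Ow] over_objD(3)[OF Od] over_objD(3)[OF Ov] by simp_all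

  \<comment> \<open>The decomposition hypothesis in the language of the slice category. It is
    available on \<open>w \<otimes> d \<otimes> v\<close> only, so the two levels of tensors are
    reduced one after the other.\<close>
  have ev: "snd ((W, i) \<otimes>\<^sub>E (D, j) \<otimes>\<^sub>E (V, k)) x = x" if x: "x \<in> carrier WDV" for x
  proof (rule tensor_linear_eq[OF W DV WDV _ _ _ x[unfolded WDV_def]])
    note l = over_objD(2)[OF over_obj_tensor[OF Ow over_obj_tensor[OF Od Ov]]]
    show "linear_map K (W \<Otimes> D \<Otimes> V) WDV (snd ((W, i) \<otimes>\<^sub>E (D, j) \<otimes>\<^sub>E (V, k)))"
      using l by (simp add: linE)
    show "linear_map K (W \<Otimes> D \<Otimes> V) WDV (\<lambda>x. x)"
      unfolding WDV_def by (rule linear_map_ident)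
    fix w t assume w: "w \<in> carrier W" and t: "t \<in> carrier (D \<Otimes> V)"
    have "i w \<otimes>\<^bsub>E\<^esub> snd ((D, j) \<otimes>\<^sub>E (V, k)) t = tens K W (D \<Otimes> V) w t"
    proof (rule tensor_linear_eq[OF mD V module_E _ _ _ t])
      show "linear_map K (D \<Otimes> V) E (\<lambda>t. i w \<otimes>\<^bsub>E\<^esub> snd ((D, j) \<otimes>\<^sub>E (V, k)) t)"
        using bilinear_mult[OF assms(10)] clo(1)[OF w] over_objD(2)[OF over_obj_tensor[OF Od Ov]]
        by (auto simp: bilinear_map_def intro: linear_map_comp)
      show "linear_map K (D \<Otimes> V) E (tens K W (D \<Otimes> V) w)"
        unfolding linE WDV_def by (rule linear_map_tens_right[OF W DV linear_map_ident w])
      fix d v assume "d \<in> carrier D" "v \<in> carrier V"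
      then show "i w \<otimes>\<^bsub>E\<^esub> snd ((D, j) \<otimes>\<^sub>E (V, k)) (tens K D V d v) = tens K W (D \<Otimes> V) w (tens K D V d v)"
        using ijk[of w d v] w clo by (simp add: snd_over_tensor[OF Od Ov] tens3_def E.m_assoc)
    qed
    then show "snd ((W, i) \<otimes>\<^sub>E (D, j) \<otimes>\<^sub>E (V, k)) (tens K W (D \<Otimes> V) w t) = tens K W (D \<Otimes> V) w t"
      using w t by (simp add: snd_over_tensor[OF Ow over_obj_tensor[OF Od Ov]])
  qed

  define A where "A = mirror_crossed_algebra K W oneW D P \<nu>"
  define \<phi> where "\<phi> = lift K W D (W \<Otimes> D \<Otimes> V) (\<lambda>w d. tens3 K W D V w d oneV)"
  define \<psi> where "\<psi> = lift K D V (W \<Otimes> D \<Otimes> V) (\<lambda>d v. tens3 K W D V oneW d v)"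
  define C where "C = crossed_algebra K D V oneV R \<sigma>"
  have AW: "same_space A (W \<Otimes> D)"
    unfolding A_def mirror_crossed_algebra_def Let_def by (rule same_space_update)
  have CD: "same_space C (D \<Otimes> V)"
    unfolding C_def crossed_algebra_def Let_def by (rule same_space_update)
  have carrier_A: "carrier A = carrier (W \<Otimes> D)" and carrier_C: "carrier C = carrier (D \<Otimes> V)"
    using AW CD by (simp_all add: same_space_def)
  have oneA: "\<one>\<^bsub>A\<^esub> = tens K W D oneW \<one>\<^bsub>D\<^esub>"
    by (simp add: A_def mirror_crossed_algebra_def Let_def)
  have \<phi>_bil: "bilinear_map K W D (W \<Otimes> D \<Otimes> V) (\<lambda>w d. tens3 K W D V w d oneV)"
    using lin3(2)[OF _ D.one_closed oneV] lin3(1)[OF oneW _ oneV]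
    by (intro bilinear_mapI) (simp_all add: WDV_def)
  have \<psi>_bil: "bilinear_map K D V (W \<Otimes> D \<Otimes> V) (\<lambda>d v. tens3 K W D V oneW d v)"
    using lin3(3)[OF oneW _ oneV] lin3(2)[OF oneW D.one_closed]
    by (intro bilinear_mapI) (simp_all add: WDV_def)
  note \<phi>_tens = lift_tens[OF W mD WDV[unfolded WDV_def] \<phi>_bil, folded \<phi>_def]
  note \<psi>_tens = lift_tens[OF mD V WDV[unfolded WDV_def] \<psi>_bil, folded \<psi>_def]
  have \<phi>_one: "\<phi> \<one>\<^bsub>A\<^esub> = \<one>\<^bsub>E\<^esub>"
    and \<phi>_mult: "\<And>x y. x \<in> carrier (W \<Otimes> D) \<Longrightarrow> y \<in> carrier (W \<Otimes> D) \<Longrightarrow>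
      \<phi> (x \<otimes>\<^bsub>A\<^esub> y) = \<phi> x \<otimes>\<^bsub>E\<^esub> \<phi> y"
    using assms(11) carrier_A by (auto simp: algebra_map_def ring_hom_def A_def \<phi>_def)
  have \<psi>_mult: "\<And>x y. x \<in> carrier (D \<Otimes> V) \<Longrightarrow> y \<in> carrier (D \<Otimes> V) \<Longrightarrow>
      \<psi> (x \<otimes>\<^bsub>C\<^esub> y) = \<psi> x \<otimes>\<^bsub>E\<^esub> \<psi> y"
    using assms(12) carrier_C by (auto simp: algebra_map_def ring_hom_def C_def \<psi>_def)
  \<comment> \<open>All three are the same element \<open>1 \<otimes> 1 \<otimes> 1\<close>, the
    image of the unit of \<open>A\<close> under \<open>\<phi>\<close>.\<close>
  have units: "i oneW = \<one>\<^bsub>E\<^esub>" "j \<one>\<^bsub>D\<^esub> = \<one>\<^bsub>E\<^esub>" "k oneV = \<one>\<^bsub>E\<^esub>"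
    using \<phi>_one oneW by (simp_all add: i_def j_def k_def oneA \<phi>_tens)
  \<comment> \<open>The value of \<open>w \<otimes> d\<close> is \<open>i w \<cdot> j d\<close>, and
    the missing factor is \<open>k oneV\<close>, the unit. So the inclusion is the structure map,
    and its multiplicativity becomes a statement about values.\<close>
  have \<phi>: "snd ((W, i) \<otimes>\<^sub>E (D, j)) t = \<phi> t" if t: "t \<in> carrier (W \<Otimes> D)" for t
  proof (rule tensor_linear_eq[OF W mD module_E _ _ _ t])
    show "linear_map K (W \<Otimes> D) E (snd ((W, i) \<otimes>\<^sub>E (D, j)))"
      using over_objD(2)[OF over_obj_tensor[OF Ow Od]] by simp
    show "linear_map K (W \<Otimes> D) E \<phi>"
      unfolding linE \<phi>_def WDV_def by (rule linear_map_lift[OF W mD WDV[unfolded WDV_def] \<phi>_bil])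
  qed (use oneV clo in \<open>simp add: \<phi>_tens snd_over_tensor[OF Ow Od] ijk units\<close>)
  have \<psi>: "snd ((D, j) \<otimes>\<^sub>E (V, k)) t = \<psi> t" if t: "t \<in> carrier (D \<Otimes> V)" for t
  proof (rule tensor_linear_eq[OF mD V module_E _ _ _ t])
    show "linear_map K (D \<Otimes> V) E (snd ((D, j) \<otimes>\<^sub>E (V, k)))"
      using over_objD(2)[OF over_obj_tensor[OF Od Ov]] by simp
    show "linear_map K (D \<Otimes> V) E \<psi>"
      unfolding linE \<psi>_def WDV_def by (rule linear_map_lift[OF mD V WDV[unfolded WDV_def] \<psi>_bil])
  qed (use oneW clo in \<open>simp add: \<psi>_tens snd_over_tensor[OF Od Ov] ijk units\<close>)

  have linP: "linear_map K (D \<Otimes> W) (W \<Otimes> D) P" and lin\<nu>: "linear_map K (W \<Otimes> W) (W \<Otimes> D) \<nu>"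
    using mirror by (simp_all add: mirror_crossed_product_def)
  have linR: "linear_map K (V \<Otimes> D) (D \<Otimes> V) R" and lin\<sigma>: "linear_map K (V \<Otimes> V) (D \<Otimes> V) \<sigma>"
    using crossed by (simp_all add: crossed_product_def)
  note lin_closed = linear_mapD(1)[OF linP] linear_mapD(1)[OF lin\<nu>] linear_mapD(1)[OF linR] linear_mapD(1)[OF lin\<sigma>]
  note tclo = tens_closed[OF mD W] tens_closed[OF W W] tens_closed[OF V mD] tens_closed[OF V V]
    tens_closed[OF W mD] tens_closed[OF mD V]
  have P_arrow: "over_arrow ((D, j) \<otimes>\<^sub>E (W, i)) (arrow_of (D \<Otimes> W) (W \<Otimes> D) P) ((W, i) \<otimes>\<^sub>E (D, j))"
  proof -
    \<comment> \<open>\<open>P(d \<otimes> w)\<close> is the product in \<open>A\<close> of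
      \<open>1 \<otimes> d\<close> and \<open>w \<otimes> 1\<close>, and \<open>\<phi>\<close> is
      multiplicative. The other three structure maps are treated alike.\<close>
    have "\<phi> (P (tens K D W d w)) = j d \<otimes>\<^bsub>E\<^esub> i w" if "d \<in> carrier D" "w \<in> carrier W" for d w
      using that \<phi>_mult[of "tens K W D oneW d" "tens K W D w \<one>\<^bsub>D\<^esub>"]
        mirror_crossed_algebra_mult_P[OF mirror, folded A_def] oneW
      by (simp add: tclo \<phi>_tens i_def j_def)
    then show ?thesis
      using over_arrow_of_tensor[OF Od Ow over_obj_tensor[OF Ow Od]] linP
      by (simp add: \<phi> lin_closed tclo)
  qed
  have \<nu>_arrow: "over_arrow ((W, i) \<otimes>\<^sub>E (W, i)) (arrow_of (W \<Otimes> W) (W \<Otimes> D) \<nu>) ((W, i) \<otimes>\<^sub>E (D, j))"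
  proof -
    have "\<phi> (\<nu> (tens K W W w w')) = i w \<otimes>\<^bsub>E\<^esub> i w'" if "w \<in> carrier W" "w' \<in> carrier W" for w w'
      using that \<phi>_mult[of "tens K W D w \<one>\<^bsub>D\<^esub>" "tens K W D w' \<one>\<^bsub>D\<^esub>"]
        mirror_crossed_algebra_mult_nu[OF mirror, folded A_def]
      by (simp add: tclo \<phi>_tens i_def)
    then show ?thesis
      using over_arrow_of_tensor[OF Ow Ow over_obj_tensor[OF Ow Od]] lin\<nu>
      by (simp add: \<phi> lin_closed tclo)
  qed
  have R_arrow: "over_arrow ((V, k) \<otimes>\<^sub>E (D, j)) (arrow_of (V \<Otimes> D) (D \<Otimes> V) R) ((D, j) \<otimes>\<^sub>E (V, k))"
  proof -
    have "\<psi> (R (tens K V D v d)) = k v \<otimes>\<^bsub>E\<^esub> j d" if "v \<in> carrier V" "d \<in> carrier D" for v d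
      using that \<psi>_mult[of "tens K D V \<one>\<^bsub>D\<^esub> v" "tens K D V d oneV"]
        crossed_algebra_mult_R[OF crossed, folded C_def] oneV
      by (simp add: tclo \<psi>_tens j_def k_def)
    then show ?thesis
      using over_arrow_of_tensor[OF Ov Od over_obj_tensor[OF Od Ov]] linR
      by (simp add: \<psi> lin_closed tclo)
  qed
  have \<sigma>_arrow: "over_arrow ((V, k) \<otimes>\<^sub>E (V, k)) (arrow_of (V \<Otimes> V) (D \<Otimes> V) \<sigma>) ((D, j) \<otimes>\<^sub>E (V, k))"
  proof -
    have "\<psi> (\<sigma> (tens K V V v v')) = k v \<otimes>\<^bsub>E\<^esub> k v'" if "v \<in> carrier V" "v' \<in> carrier V" for v v'
      using that \<psi>_mult[of "tens K D V \<one>\<^bsub>D\<^esub> v" "tens K D V \<one>\<^bsub>D\<^esub> v'"]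
        crossed_algebra_mult_sigma[OF crossed, folded C_def]
      by (simp add: tclo \<psi>_tens k_def)
    then show ?thesis
      using over_arrow_of_tensor[OF Ov Ov over_obj_tensor[OF Od Ov]] lin\<sigma>
      by (simp add: \<psi> lin_closed tclo)
  qed
  have \<mu>_arrow: "over_arrow ((D, j) \<otimes>\<^sub>E (D, j)) (mult_arrow K D) (D, j)"
  proof (rule over_arrow_mult[OF Od bilinear_mult[OF D]])
    show "j (d \<otimes>\<^bsub>D\<^esub> d') = j d \<otimes>\<^bsub>E\<^esub> j d'" if "d \<in> carrier D" "d' \<in> carrier D" for d d'
      using that \<phi>_mult[of "tens K W D oneW d" "tens K W D oneW d'"]
        mirror_crossed_algebra_mult_base[OF mirror, folded A_def] oneW
      by (simp add: tclo \<phi>_tens j_def)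
  qed

  \<comment> \<open>The structure map itself: its values lie in \<open>E\<close>, whose elements are
    those of \<open>W \<Otimes> D \<Otimes> V\<close>, so it is at the same time the required map,
    linear by construction.\<close>
  define Q where "Q = snd ((V, k) \<otimes>\<^sub>E (W, i))"
  have Q_tens: "Q (tens K V W v w) = k v \<otimes>\<^bsub>E\<^esub> i w" if "v \<in> carrier V" "w \<in> carrier W" for v w
    using that by (simp add: Q_def snd_over_tensor[OF Ov Ow])
  have linQ: "linear_map K (V \<Otimes> W) (W \<Otimes> D \<Otimes> V) Q"
    using over_objD(2)[OF over_obj_tensor[OF Ov Ow]] by (simp add: Q_def linE WDV_def)
  have Q_arrow: "over_arrow ((V, k) \<otimes>\<^sub>E (W, i)) (arrow_of (V \<Otimes> W) (W \<Otimes> D \<Otimes> V) Q) ((W, i) \<otimes>\<^sub>E (D, j) \<otimes>\<^sub>E (V, k))"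
  proof -
    have "snd ((W, i) \<otimes>\<^sub>E (D, j) \<otimes>\<^sub>E (V, k)) (Q (tens K V W v w)) = k v \<otimes>\<^bsub>E\<^esub> i w"
      if "v \<in> carrier V" "w \<in> carrier W" for v w
      using that ev[of "k v \<otimes>\<^bsub>E\<^esub> i w"] clo E.m_closed by (simp add: Q_tens carrier_E)
    then show ?thesis
      using over_arrow_of_tensor[OF Ov Ow over_obj_tensor[OF Ow over_obj_tensor[OF Od Ov]], of Q] linQ
      by simp
  qed
  have inj: "inj_on (snd ((W, i) \<otimes>\<^sub>E (D, j) \<otimes>\<^sub>E (V, k))) (carrier (fst ((W, i) \<otimes>\<^sub>E (D, j) \<otimes>\<^sub>E (V, k))))"
    by (rule inj_onI) (simp add: ev WDV_def)
  note arrows = over_arrow_tensor over_arrow_ident over_arrow_21 over_arrow_22 over_arrow_23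
    obj P_arrow \<nu>_arrow R_arrow \<sigma>_arrow \<mu>_arrow Q_arrow
  have "iteration_map K W oneW D V oneV P \<nu> R \<sigma> Q"
    unfolding iteration_map_def Let_def
  proof (intro conjI ballI)
    show "linear_map K (V \<Otimes> W) (W \<Otimes> D \<Otimes> V) Q"
      by (rule linQ)
    show "Q (tens K V W oneV w) = tens3 K W D V w \<one>\<^bsub>D\<^esub> oneV" if "w \<in> carrier W" for w
      using that oneV clo by (simp add: Q_tens units) (simp add: i_def)
    show "Q (tens K V W v oneW) = tens3 K W D V oneW \<one>\<^bsub>D\<^esub> v" if "v \<in> carrier V" for v
      using that oneW clo by (simp add: Q_tens units) (simp add: k_def)
  \<comment> \<open>The goals left are (a), (b) and (c). Building the arrow on one side determines
    the common source object, and the other side has to fit it.\<close>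
  qed (rule over_arrow_unique[OF _ _ inj], ((rule over_arrow_comp arrows)+)[1], ((rule over_arrow_comp arrows)+)[1])+
  moreover have "same_algebra K E (iterated_crossed_algebra K W oneW D V oneV P \<nu> R \<sigma> Q)"
  proof -
    \<comment> \<open>The same function as the structure map of \<open>W \<Otimes> D\<close>, now
      attached to the algebra record \<open>A\<close>.\<close>
    define \<alpha> where "\<alpha> = snd ((W, i) \<otimes>\<^sub>E (D, j))"
    define l where "l = app (assoc_left K W D V)"
    define r where "r = app (assoc_right K W D V)"
    define R' where "R' = tensor_arrow K (ident W) (tensor_arrow_21 K (mult_arrow K D) (ident V)) \<circ>\<^sub>a
      tensor_arrow K (ident W) (tensor_arrow K (ident D) (arrow_of (V \<Otimes> D) (D \<Otimes> V) R)) \<circ>\<^sub>a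
      tensor_arrow_23 K (arrow_of (V \<Otimes> W) (W \<Otimes> D \<Otimes> V) Q) (ident D)"
    define Rbar where "Rbar = (\<lambda>t. l (app R' t))"
    define \<sigma>bar where "\<sigma>bar = (\<lambda>t. l (tens K W (D \<Otimes> V) oneW (\<sigma> t)))"
    define C' where "C' = crossed_algebra K A V oneV Rbar \<sigma>bar"
    have iterated: "iterated_crossed_algebra K W oneW D V oneV P \<nu> R \<sigma> Q =
        WDV\<lparr>mult := (\<lambda>x y. r (l x \<otimes>\<^bsub>C'\<^esub> l y)), one := r \<one>\<^bsub>C'\<^esub>\<rparr>"
      unfolding iterated_crossed_algebra_def Let_def C'_def Rbar_def \<sigma>bar_def R'_def l_def r_def A_def WDV_def
      by (rule refl)
    have AV: "same_space (A \<Otimes> V) ((W \<Otimes> D) \<Otimes> V)" and VA: "same_space (V \<Otimes> A) (V \<Otimes> W \<Otimes> D)"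
      by (intro tensor_same_space same_space_refl AW)+
    have carrier_AV: "carrier (A \<Otimes> V) = carrier ((W \<Otimes> D) \<Otimes> V)" "carrier (V \<Otimes> A) = carrier (V \<Otimes> W \<Otimes> D)"
      using AV VA by (simp_all add: same_space_def)
    have OA: "over_obj (A, \<alpha>)"
      using module_same_space[OF AW WD] over_objD(2)[OF over_obj_tensor[OF Ow Od]]
      by (simp add: over_obj_def \<alpha>_def linear_map_same_space[OF AW same_space_refl])
    \<comment> \<open>The rebracketing maps live on \<open>W\<close>, \<open>D\<close>,
      \<open>V\<close>, the crossed product on \<open>A\<close> and \<open>V\<close>. Equal
      structure maps allow values to be compared across the two records.\<close>
    have snd_AV: "snd ((A, \<alpha>) \<otimes>\<^sub>E (V, k)) = snd (((W, i) \<otimes>\<^sub>E (D, j)) \<otimes>\<^sub>E (V, k))"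
      and snd_VA: "snd ((V, k) \<otimes>\<^sub>E (A, \<alpha>)) = snd ((V, k) \<otimes>\<^sub>E (W, i) \<otimes>\<^sub>E (D, j))"
      unfolding over_tensor_def[of K E "(A, \<alpha>)"] over_tensor_def[of K E _ "(A, \<alpha>)"]
        over_tensor_def[of K E "(W, i) \<otimes>\<^sub>E (D, j)"] over_tensor_def[of K E _ "(W, i) \<otimes>\<^sub>E (D, j)"]
      by (simp_all add: \<alpha>_def lift_same_space[OF AW same_space_refl] lift_same_space[OF same_space_refl AW])
    have A_bil: "bilinear_map K (W \<Otimes> D) (W \<Otimes> D) (W \<Otimes> D) (mult A)"
      unfolding A_def by (rule bilinear_mirror_crossed_algebra[OF mirror])
    have \<mu>A: "over_arrow ((A, \<alpha>) \<otimes>\<^sub>E (A, \<alpha>)) (mult_arrow K A) (A, \<alpha>)"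
    proof (rule over_arrow_mult[OF OA])
      show "bilinear_map K A A A (mult A)"
        using A_bil by (simp add: bilinear_map_def linear_map_same_space[OF AW AW] carrier_A)
      show "\<alpha> (x \<otimes>\<^bsub>A\<^esub> y) = \<alpha> x \<otimes>\<^bsub>E\<^esub> \<alpha> y" if "x \<in> carrier A" "y \<in> carrier A" for x y
        using that \<phi>_mult bilinear_mapD(1)[OF A_bil] by (simp add: \<alpha>_def carrier_A \<phi>)
    qed
    have l_arrow: "over_arrow ((W, i) \<otimes>\<^sub>E (D, j) \<otimes>\<^sub>E (V, k)) (assoc_left K W D V) (((W, i) \<otimes>\<^sub>E (D, j)) \<otimes>\<^sub>E (V, k))"
      using over_arrow_assoc_left[OF Ow Od Ov] by simp
    have r_arrow: "over_arrow (((W, i) \<otimes>\<^sub>E (D, j)) \<otimes>\<^sub>E (V, k)) (assoc_right K W D V) ((W, i) \<otimes>\<^sub>E (D, j) \<otimes>\<^sub>E (V, k))"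
      using over_arrow_assoc_right[OF Ow Od Ov] by simp
    have R'_arrow: "over_arrow ((V, k) \<otimes>\<^sub>E (W, i) \<otimes>\<^sub>E (D, j)) R' ((W, i) \<otimes>\<^sub>E (D, j) \<otimes>\<^sub>E (V, k))"
      unfolding R'_def by (rule over_arrow_comp arrows)+
    note lD = over_arrowD[OF l_arrow, folded l_def] and rD = over_arrowD[OF r_arrow, folded r_def]
      and R'D = over_arrowD[OF R'_arrow]
    have lin_l: "linear_map K (W \<Otimes> D \<Otimes> V) ((W \<Otimes> D) \<Otimes> V) l"
      using lin_arrowD(3)[OF lD(3)] by (simp add: l_def)
    \<comment> \<open>\<open>Rbar\<close> is a bare function between spaces built on
      \<open>A\<close>, not a composite of arrows, so its triangle is assembled from those of
      \<open>R'\<close> and \<open>l\<close>.\<close>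
    have Rbar_arrow: "over_arrow ((V, k) \<otimes>\<^sub>E (A, \<alpha>)) (arrow_of (V \<Otimes> A) (A \<Otimes> V) Rbar) ((A, \<alpha>) \<otimes>\<^sub>E (V, k))"
    proof -
      have "linear_map K (V \<Otimes> A) (A \<Otimes> V) Rbar"
        using linear_map_comp[OF lin_arrowD(3)[OF R'D(3)], of "(W \<Otimes> D) \<Otimes> V" l] lin_l R'D(4,5)
        by (simp add: linear_map_same_space[OF VA AV] Rbar_def)
      moreover have "snd ((A, \<alpha>) \<otimes>\<^sub>E (V, k)) (Rbar t) = snd ((V, k) \<otimes>\<^sub>E (A, \<alpha>)) t"
        if "t \<in> carrier (V \<Otimes> A)" for t
        using that R'D(6,7)[of t] lD(6)[of "app R' t"] by (simp add: snd_AV snd_VA Rbar_def carrier_AV)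
      ultimately show ?thesis
        using over_arrow_of[OF over_obj_tensor[OF Ov OA] over_obj_tensor[OF OA Ov], of Rbar] by simp
    qed
    have \<sigma>bar_arrow: "over_arrow ((V, k) \<otimes>\<^sub>E (V, k)) (arrow_of (V \<Otimes> V) (A \<Otimes> V) \<sigma>bar) ((A, \<alpha>) \<otimes>\<^sub>E (V, k))"
    proof -
      have "linear_map K (V \<Otimes> V) (A \<Otimes> V) \<sigma>bar"
        using linear_map_comp[OF linear_map_tens_right[OF W DV lin\<sigma> oneW] lin_l]
        by (simp add: linear_map_same_space[OF same_space_refl AV] \<sigma>bar_def)
      moreover have "snd ((A, \<alpha>) \<otimes>\<^sub>E (V, k)) (\<sigma>bar t) = snd ((V, k) \<otimes>\<^sub>E (V, k)) t"
        if t: "t \<in> carrier (V \<Otimes> V)" for t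
      proof -
        have \<sigma>t: "\<sigma> t \<in> carrier (D \<Otimes> V)"
          using lin_closed t by blast
        have "snd ((A, \<alpha>) \<otimes>\<^sub>E (V, k)) (\<sigma>bar t) =
            snd ((W, i) \<otimes>\<^sub>E (D, j) \<otimes>\<^sub>E (V, k)) (tens K W (D \<Otimes> V) oneW (\<sigma> t))"
          using lD(6)[of "tens K W (D \<Otimes> V) oneW (\<sigma> t)"] tens_closed[OF W DV oneW \<sigma>t]
          by (simp add: snd_AV \<sigma>bar_def)
        \<comment> \<open>The prefixed \<open>oneW\<close> contributes the factor
          \<open>i oneW\<close>, the unit of \<open>E\<close>.\<close>
        also have "\<dots> = snd ((D, j) \<otimes>\<^sub>E (V, k)) (\<sigma> t)"
          using oneW \<sigma>t over_objD(3)[OF over_obj_tensor[OF Od Ov]]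
          by (simp add: snd_over_tensor[OF Ow over_obj_tensor[OF Od Ov]] units)
        also have "\<dots> = snd ((V, k) \<otimes>\<^sub>E (V, k)) t"
          using over_arrowD(6)[OF \<sigma>_arrow, of t] t by simp
        finally show ?thesis .
      qed
      ultimately show ?thesis
        using over_arrow_of[OF over_obj_tensor[OF Ov Ov] over_obj_tensor[OF OA Ov], of \<sigma>bar] by simp
    qed
    note C'_mult = over_crossed_algebra_mult[OF OA Ov \<mu>A Rbar_arrow \<sigma>bar_arrow, of _ _ oneV, folded C'_def]
    have mult: "x \<otimes>\<^bsub>E\<^esub> y = r (l x \<otimes>\<^bsub>C'\<^esub> l y)" if x: "x \<in> carrier E" and y: "y \<in> carrier E" for x y
    proof -
      have xy: "x \<in> carrier WDV" "y \<in> carrier WDV"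
        using x y by (simp_all add: carrier_E)
      then have lxy: "l x \<in> carrier (A \<Otimes> V)" "l y \<in> carrier (A \<Otimes> V)"
        using lD(7) by (simp_all add: carrier_AV WDV_def)
      note z = C'_mult(1)[OF lxy, unfolded carrier_AV]
      \<comment> \<open>An element of \<open>W \<Otimes> D \<Otimes> V\<close> is its own value, so
        the transported product may be followed through \<open>r\<close>, the product of
        \<open>C'\<close> and \<open>l\<close> by values alone.\<close>
      have "r (l x \<otimes>\<^bsub>C'\<^esub> l y) = snd ((W, i) \<otimes>\<^sub>E (D, j) \<otimes>\<^sub>E (V, k)) (r (l x \<otimes>\<^bsub>C'\<^esub> l y))"
        using rD(7)[of "l x \<otimes>\<^bsub>C'\<^esub> l y"] z by (simp add: ev WDV_def)
      also have "\<dots> = snd ((A, \<alpha>) \<otimes>\<^sub>E (V, k)) (l x \<otimes>\<^bsub>C'\<^esub> l y)"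
        using rD(6)[of "l x \<otimes>\<^bsub>C'\<^esub> l y"] z by (simp add: snd_AV)
      also have "\<dots> = snd ((A, \<alpha>) \<otimes>\<^sub>E (V, k)) (l x) \<otimes>\<^bsub>E\<^esub> snd ((A, \<alpha>) \<otimes>\<^sub>E (V, k)) (l y)"
        by (rule C'_mult(2)[OF lxy])
      also have "\<dots> = x \<otimes>\<^bsub>E\<^esub> y"
        using lD(6) xy by (simp add: snd_AV ev WDV_def)
      finally show ?thesis by simp
    qed
    have "\<one>\<^bsub>C'\<^esub> = tens K A V \<one>\<^bsub>A\<^esub> oneV"
      by (simp add: C'_def crossed_algebra_def Let_def)
    then have one: "\<one>\<^bsub>E\<^esub> = r \<one>\<^bsub>C'\<^esub>"
      using app_assoc_right[OF W mD V oneW D.one_closed oneV] units(1)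
      by (simp add: tens_same_space[OF AW same_space_refl] oneA r_def i_def tens3_def)
    \<comment> \<open>Zero, addition and scalars agree because \<open>E\<close> and the iterated
      algebra both alter only \<open>mult\<close> and \<open>one\<close> of the same space.\<close>
    show ?thesis
      unfolding iterated same_algebra_def using EW mult one by (simp add: same_space_def)
  qed
  ultimately show ?thesis
    using Q_tens by (auto simp: i_def k_def)
qed

end
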